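(* The class of outerplanar graphs is fractionally $\mathrm{td}$-fragile at rate $r(a)=2a(1+\lceil\log_2 a\rceil)$.
   Context: All graphs are finite. The treedepth $\mathrm{td}(G)$ of a graph $G$ is the minimum integer $d$ for which there exists a rooted forest $T$ of depth at most $d-1$ (each vertex is at distance at most $d-1$ from the root of its tree) with vertex set $V(G)$ such that every edge of $G$ joins a vertex to one of its ancestors or descendants in $T$; the empty graph has treedepth $0$. For $\varepsilon>0$, a probability distribution on subsets of $V(G)$ is $\varepsilon$-thin if for each vertex $v$, the probability that $v$ belongs to a set sampled from the distribution is at most $\varepsilon$. For a graph parameter $f$ and a non-decreasing function $r\colon\mathbb{N}\to\mathbb{R}_0^+$, a graph $G$ is fractionally $f$-fragile at rate $r$ if for every positive integer $a$ there exists a $(1/a)$-thin probability distribution on the collection of sets $Y\subseteq V(G)$ satisfying $f(G-Y)\le r(a)$. A class of graphs is fractionally $f$-fragile at rate $r$ if every graph in the class is. *)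

theory Defs
  imports "HOL-Probability.Probability"
begin

record 'a ugraph =
  verts :: "'a set"
  edges :: "'a set set"

definition simple_graph :: "'a ugraph \<Rightarrow> bool" where
  "simple_graph G \<longleftrightarrow>
     finite (verts G) \<and> (\<forall>e\<in>edges G. e \<subseteq> verts G \<and> card e = 2)"

definition delete_verts :: "'a ugraph \<Rightarrow> 'a set \<Rightarrow> 'a ugraph" where
  "delete_verts G Y = \<lparr>verts = verts G - Y, edges = {e \<in> edges G. e \<inter> Y = {}}\<rparr>"


(* A rooted forest is given by its set P of (child, parent) pairs: u is a proper ancestor of v
   iff (v, u) is in P^+, and the roots are the vertices without a parent. *)

definition rooted_forest :: "'a set \<Rightarrow> ('a \<times> 'a) set \<Rightarrow> bool" where
  "rooted_forest V P \<longleftrightarrow> P \<subseteq> V \<times> V \<and> single_valued P \<and> acyclic P"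

definition forest_roots :: "'a set \<Rightarrow> ('a \<times> 'a) set \<Rightarrow> 'a set" where
  "forest_roots V P = V - Domain P"

(* "Depth at most d - 1", phrased as "distance to the root less than d" so that for d = 0
   it holds exactly for the empty forest. *)

definition forest_depth_less :: "'a set \<Rightarrow> ('a \<times> 'a) set \<Rightarrow> nat \<Rightarrow> bool" where
  "forest_depth_less V P d \<longleftrightarrow>
     (\<forall>v\<in>V. \<exists>r\<in>forest_roots V P. \<exists>n<d. (v, r) \<in> P ^^ n)"

definition ancestor_closed :: "'a ugraph \<Rightarrow> ('a \<times> 'a) set \<Rightarrow> bool" where
  "ancestor_closed G P \<longleftrightarrow>
     (\<forall>u v. {u, v} \<in> edges G \<longrightarrow> (u, v) \<in> P\<^sup>+ \<or> (v, u) \<in> P\<^sup>+)"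

definition treedepth :: "'a ugraph \<Rightarrow> nat" where
  "treedepth G =
     (LEAST d. \<exists>P. rooted_forest (verts G) P \<and> forest_depth_less (verts G) P d \<and>
                   ancestor_closed G P)"


definition plane_drawing ::
    "'a ugraph \<Rightarrow> ('a \<Rightarrow> complex) \<Rightarrow> ('a set \<Rightarrow> real \<Rightarrow> complex) \<Rightarrow> bool" where
  "plane_drawing G p \<gamma> \<longleftrightarrow>
     inj_on p (verts G) \<and>
     (\<forall>e\<in>edges G. arc (\<gamma> e) \<and> {pathstart (\<gamma> e), pathfinish (\<gamma> e)} = p ` e \<and>
        path_image (\<gamma> e) \<inter> p ` verts G = p ` e) \<and>
     (\<forall>e\<in>edges G. \<forall>e'\<in>edges G. e \<noteq> e' \<longrightarrow>
        path_image (\<gamma> e) \<inter> path_image (\<gamma> e') = p ` (e \<inter> e'))"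

definition drawing_image ::
    "'a ugraph \<Rightarrow> ('a \<Rightarrow> complex) \<Rightarrow> ('a set \<Rightarrow> real \<Rightarrow> complex) \<Rightarrow> complex set" where
  "drawing_image G p \<gamma> = p ` verts G \<union> (\<Union>e\<in>edges G. path_image (\<gamma> e))"

(* The image of a drawing of a finite graph is compact, so its outside is exactly
   the unique unbounded face. *)

definition outerplanar :: "'a ugraph \<Rightarrow> bool" where
  "outerplanar G \<longleftrightarrow>
     (\<exists>p \<gamma>. plane_drawing G p \<gamma> \<and>
        (\<forall>v\<in>verts G. p v \<in> frontier (outside (drawing_image G p \<gamma>))))"

definition outerplanar_graphs :: "'a ugraph set" where
  "outerplanar_graphs = {G. simple_graph G \<and> outerplanar G}"


(* On the finitely many subsets of the vertex set, every probability distribution is a pmf. *)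

definition thin :: "real \<Rightarrow> 'a ugraph \<Rightarrow> 'a set pmf \<Rightarrow> bool" where
  "thin \<epsilon> G D \<longleftrightarrow>
     set_pmf D \<subseteq> Pow (verts G) \<and>
     (\<forall>v\<in>verts G. measure_pmf.prob D {Y. v \<in> Y} \<le> \<epsilon>)"

definition fractionally_fragile ::
    "('a ugraph \<Rightarrow> real) \<Rightarrow> (nat \<Rightarrow> real) \<Rightarrow> 'a ugraph \<Rightarrow> bool" where
  "fractionally_fragile f r G \<longleftrightarrow>
     mono r \<and> (\<forall>a. r a \<ge> 0) \<and>
     (\<forall>a>0. \<exists>D. thin (1 / real a) G D \<and>
        set_pmf D \<subseteq> {Y. Y \<subseteq> verts G \<and> f (delete_verts G Y) \<le> r a})"

definition class_fractionally_fragile ::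
    "('a ugraph \<Rightarrow> real) \<Rightarrow> (nat \<Rightarrow> real) \<Rightarrow> 'a ugraph set \<Rightarrow> bool" where
  "class_fractionally_fragile f r C \<longleftrightarrow> (\<forall>G\<in>C. fractionally_fragile f r G)"

end

theory Submission imports Defs begin

text \<open>
In an outerplanar drawing no vertex lies inside a closed curve of the drawing. Applied to theta curves,
this excludes three internally disjoint paths of length at least two with common ends, as well as two
crossing chords of a cycle. Hence a longest cycle in a nonseparable part is Hamiltonian (an ear would
lengthen it or close a theta), its cyclic order is noncrossing, and the orders of the parts can be glued
at cut vertices: the vertices are points on a line so that no two edges cross.

An open interval whose vertices have no neighbours beyond its end points \<open>l\<close>, \<open>r\<close> is cut by the
neighbours of \<open>l\<close> and \<open>r\<close> in it: no edge passes over such a neighbour inside the interval, so the gaps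
are intervals of the same kind. This gives every vertex a level (depth of the recursion) and an index
(within its chain of neighbours). With \<open>M = 2 * a\<close>, delete for uniformly random \<open>i < M\<close> the vertices whose
level or index is congruent to \<open>i\<close>. The rest falls into pieces with fewer than \<open>M\<close> levels, and each level
costs at most \<open>\<lceil>log 2 M\<rceil>\<close>, by bisecting runs of fewer than \<open>M\<close> consecutive chain vertices.
\<close>

section \<open>Treedepth\<close>

text \<open>Treedepth in recursive form, without a forest: \<open>remove\<close> spends one unit on
  a root, \<open>union\<close> puts two parts without edges between them side by side at no cost. As
  \<open>empty\<close> holds for every \<open>d\<close>, the number is only an upper bound.\<close>

inductive td_at_most :: "('a \<Rightarrow> 'a \<Rightarrow> bool) \<Rightarrow> 'a set \<Rightarrow> nat \<Rightarrow> bool" for R where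
  empty: "td_at_most R {} d"
| remove: "v \<in> A \<Longrightarrow> td_at_most R (A - {v}) d \<Longrightarrow> td_at_most R A (Suc d)"
| union: "td_at_most R A d \<Longrightarrow> td_at_most R B d \<Longrightarrow> A \<inter> B = {} \<Longrightarrow>
    (\<And>x y. x \<in> A \<Longrightarrow> y \<in> B \<Longrightarrow> \<not> R x y \<and> \<not> R y x) \<Longrightarrow> td_at_most R (A \<union> B) d"

lemma td_at_most_mono:
  assumes "td_at_most R A d" "B \<subseteq> A" "d \<le> e"
  shows "td_at_most R B e"
  using assms
proof (induction arbitrary: B e rule: td_at_most.induct)
  case (empty d)
  then show ?case by (simp add: td_at_most.empty)
next
  case (remove v A d)
  show ?case
  proof (cases "v \<in> B")
    case True
    from remove.prems(2) obtain e' where e: "e = Suc e'" "d \<le> e'" by (cases e) auto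
    have "td_at_most R (B - {v}) e'"
      using remove.prems(1) e by (intro remove.IH) auto
    then show ?thesis using td_at_most.remove True e by metis
  next
    case False
    then show ?thesis using remove.prems by (intro remove.IH) auto
  qed
next
  case (union A d B C)
  have "td_at_most R (A \<inter> C \<union> B \<inter> C) e"
  proof (rule td_at_most.union)
    show "td_at_most R (A \<inter> C) e" "td_at_most R (B \<inter> C) e"
      using union by auto
  qed (use union in auto)
  moreover have "A \<inter> C \<union> B \<inter> C = C" using union.prems by auto
  ultimately show ?case by simp
qed

lemma td_at_most_UN:
  assumes "finite I" "\<And>i. i \<in> I \<Longrightarrow> td_at_most R (A i) d"
    and "\<And>i j x y. i \<in> I \<Longrightarrow> j \<in> I \<Longrightarrow> i \<noteq> j \<Longrightarrow> x \<in> A i \<Longrightarrow> y \<in> A j \<Longrightarrow> x \<noteq> y \<and> \<not> R x y"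
  shows "td_at_most R (\<Union>i\<in>I. A i) d"
  using assms
proof (induction I rule: finite_induct)
  case empty
  then show ?case by (simp add: td_at_most.empty)
next
  case (insert a I)
  have "td_at_most R (A a \<union> (\<Union>i\<in>I. A i)) d"
  proof (rule td_at_most.union)
    show "td_at_most R (\<Union>i\<in>I. A i) d"
      by (rule insert.IH) (use insert.prems in \<open>blast+\<close>)
    show "td_at_most R (A a) d" using insert.prems by simp
    show "A a \<inter> (\<Union>i\<in>I. A i) = {}"
      using insert.prems(2) insert.hyps(2) by (fastforce simp: disjoint_iff)
    show "\<not> R x y \<and> \<not> R y x" if "x \<in> A a" "y \<in> (\<Union>i\<in>I. A i)" for x y
      using insert.prems(2) insert.hyps(2) that by (metis UN_E insertCI)
  qed
  then show ?case by simp
qed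

text \<open>Serves to carry a bound proved for positions on the line back to the vertices; for this
  it is enough that edges are mapped to edges.\<close>

lemma td_at_most_inj_image:
  assumes "td_at_most R (f ` W) d" "inj_on f W"
    and "\<And>x y. x \<in> W \<Longrightarrow> y \<in> W \<Longrightarrow> Q x y \<Longrightarrow> R (f x) (f y)"
  shows "td_at_most Q W d"
  using assms
proof (induction "f ` W" d arbitrary: W rule: td_at_most.induct)
  case (empty d)
  then show ?case by (simp add: td_at_most.empty)
next
  case (remove v d)
  then obtain w where w: "w \<in> W" "v = f w" by auto
  have "td_at_most Q (W - {w}) d"
  proof (rule remove.hyps(3))
    show "f ` W - {v} = f ` (W - {w})"
      using w remove.prems(1) by (auto simp: inj_on_def)
    show "inj_on f (W - {w})" using remove.prems(1) by (rule inj_on_diff)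
  qed (use remove.prems in auto)
  with w show ?case by (auto intro: td_at_most.remove)
next
  case (union A d B)
  have sub: "A \<subseteq> f ` W" "B \<subseteq> f ` W" using union.hyps by auto
  have "td_at_most Q ((f -` A \<inter> W) \<union> (f -` B \<inter> W)) d"
  proof (rule td_at_most.union)
    show "td_at_most Q (f -` A \<inter> W) d"
      by (rule union.hyps(2)) (use sub union.prems in \<open>auto intro: inj_on_subset\<close>)
    show "td_at_most Q (f -` B \<inter> W) d"
      by (rule union.hyps(4)) (use sub union.prems in \<open>auto intro: inj_on_subset\<close>)
    show "(f -` A \<inter> W) \<inter> (f -` B \<inter> W) = {}" using union.hyps by auto
    show "\<not> Q x y \<and> \<not> Q y x" if "x \<in> f -` A \<inter> W" "y \<in> f -` B \<inter> W" for x y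
      using that union.hyps(6)[of "f x" "f y"] union.prems(2) by auto
  qed
  moreover have "(f -` A \<inter> W) \<union> (f -` B \<inter> W) = W" using union.hyps by auto
  ultimately show ?case by simp
qed

lemma relpow_subset_mono:
  fixes P Q :: "('a \<times> 'a) set"
  assumes "P \<subseteq> Q" "(x, y) \<in> P ^^ n"
  shows "(x, y) \<in> Q ^^ n"
  using assms(2) by (induction n arbitrary: y) (use assms(1) in auto)

text \<open>The forest grows along the derivation: \<open>remove\<close> hangs all previous roots
  below \<open>v\<close>, and \<open>union\<close> takes the union of the two parent relations.
  Irreflexivity of \<open>R\<close> excludes a loop at \<open>v\<close>, which no ancestor relation
  could cover.\<close>

lemma td_at_most_forest:
  assumes "td_at_most R A d" "\<And>x. \<not> R x x"
  shows "\<exists>P. rooted_forest A P \<and> forest_depth_less A P d \<and>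
    (\<forall>x\<in>A. \<forall>y\<in>A. R x y \<longrightarrow> (x, y) \<in> P\<^sup>+ \<or> (y, x) \<in> P\<^sup>+)"
  using assms
proof (induction rule: td_at_most.induct)
  case (empty d)
  show ?case
    by (rule exI[of _ "{}"]) (simp add: rooted_forest_def forest_depth_less_def acyclic_def)
next
  case (remove v A d)
  from remove.IH[OF remove.prems] obtain P where P: "P \<subseteq> (A - {v}) \<times> (A - {v})" "single_valued P" "acyclic P"
    and depth: "\<And>x. x \<in> A - {v} \<Longrightarrow> \<exists>r\<in>A - {v} - Domain P. \<exists>n<d. (x, r) \<in> P ^^ n"
    and anc: "\<And>x y. x \<in> A - {v} \<Longrightarrow> y \<in> A - {v} \<Longrightarrow> R x y \<Longrightarrow> (x, y) \<in> P\<^sup>+ \<or> (y, x) \<in> P\<^sup>+"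
    unfolding rooted_forest_def forest_depth_less_def forest_roots_def by blast
  \<comment> \<open>All roots of \<open>P\<close> become children of the new root
    \<open>v\<close>.\<close>
  define Q where "Q = P \<union> (A - {v} - Domain P) \<times> {v}"
  have PQ: "P \<subseteq> Q" by (auto simp: Q_def)
  have vD: "v \<notin> Domain Q" using P(1) by (auto simp: Q_def)
  \<comment> \<open>Since \<open>v\<close> has no parent, a chain in \<open>Q\<close> can use a new
    pair only as its last step.\<close>
  have QE: "y = v \<or> (x, y) \<in> P\<^sup>+" if "(x, y) \<in> Q\<^sup>+" for x y
    using that
  proof (induction rule: trancl_induct)
    case (base y)
    then show ?case by (auto simp: Q_def)
  next
    case (step y z)
    then show ?case using vD unfolding Q_def
      by (auto intro: trancl_into_trancl)
  qed
  have "acyclic Q"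
    unfolding acyclic_def
  proof (intro allI notI)
    fix x assume x: "(x, x) \<in> Q\<^sup>+"
    then have "x \<noteq> v" using vD by (auto dest: tranclD)
    then show False using QE[OF x] P(3) by (auto simp: acyclic_def)
  qed
  moreover have "single_valued Q"
    using P(1,2) unfolding Q_def single_valued_def by auto
  ultimately have "rooted_forest A Q"
    using P(1) \<open>v \<in> A\<close> unfolding rooted_forest_def Q_def by auto
  moreover have up: "\<exists>n<d. (x, v) \<in> Q ^^ Suc n" if x: "x \<in> A - {v}" for x
  proof -
    obtain r n where r: "r \<in> A - {v} - Domain P" "n < d" "(x, r) \<in> P ^^ n"
      using depth[OF x] by blast
    have "(r, v) \<in> Q" using r(1) by (auto simp: Q_def)
    then show ?thesis using relpow_subset_mono[OF PQ r(3)] r(2) by (auto intro: relcompI)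
  qed
  have "forest_depth_less A Q (Suc d)"
    unfolding forest_depth_less_def forest_roots_def
  proof
    fix x assume "x \<in> A"
    show "\<exists>r\<in>A - Domain Q. \<exists>n<Suc d. (x, r) \<in> Q ^^ n"
    proof (rule bexI[of _ v])
      show "\<exists>n<Suc d. (x, v) \<in> Q ^^ n"
      proof (cases "x = v")
        case True
        then show ?thesis by (intro exI[of _ 0]) auto
      next
        case False
        then show ?thesis using up[of x] \<open>x \<in> A\<close> by (metis DiffI Suc_less_eq singletonD)
      qed
    qed (use vD \<open>v \<in> A\<close> in auto)
  qed
  moreover have upt: "(x, v) \<in> Q\<^sup>+" if "x \<in> A - {v}" for x
    using up[OF that] by (meson trancl_power zero_less_Suc)
  have "(x, y) \<in> Q\<^sup>+ \<or> (y, x) \<in> Q\<^sup>+" if xy: "x \<in> A" "y \<in> A" "R x y" for x y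
  proof -
    consider "x = v" "y \<noteq> v" | "x \<noteq> v" "y = v" | "x \<noteq> v" "y \<noteq> v"
      using xy remove.prems by blast
    then show ?thesis
    proof cases
      case 1 then show ?thesis using upt[of y] xy by auto
    next
      case 2 then show ?thesis using upt[of x] xy by auto
    next
      case 3
      then show ?thesis using anc[of x y] xy trancl_mono[OF _ PQ] by auto
    qed
  qed
  ultimately show ?case by blast
next
  case (union A d B)
  from union.IH(1)[OF union.prems] obtain P where P: "P \<subseteq> A \<times> A" "single_valued P" "acyclic P"
    and Pd: "\<And>x. x \<in> A \<Longrightarrow> \<exists>r\<in>A - Domain P. \<exists>n<d. (x, r) \<in> P ^^ n"
    and Pa: "\<And>x y. x \<in> A \<Longrightarrow> y \<in> A \<Longrightarrow> R x y \<Longrightarrow> (x, y) \<in> P\<^sup>+ \<or> (y, x) \<in> P\<^sup>+"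
    unfolding rooted_forest_def forest_depth_less_def forest_roots_def by blast
  from union.IH(2)[OF union.prems] obtain Q where Q: "Q \<subseteq> B \<times> B" "single_valued Q" "acyclic Q"
    and Qd: "\<And>x. x \<in> B \<Longrightarrow> \<exists>r\<in>B - Domain Q. \<exists>n<d. (x, r) \<in> Q ^^ n"
    and Qa: "\<And>x y. x \<in> B \<Longrightarrow> y \<in> B \<Longrightarrow> R x y \<Longrightarrow> (x, y) \<in> Q\<^sup>+ \<or> (y, x) \<in> Q\<^sup>+"
    unfolding rooted_forest_def forest_depth_less_def forest_roots_def by blast
  note dis = \<open>A \<inter> B = {}\<close>
  have E: "(x, y) \<in> P\<^sup>+ \<and> y \<in> A \<or> (x, y) \<in> Q\<^sup>+ \<and> y \<in> B" if "(x, y) \<in> (P \<union> Q)\<^sup>+" for x y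
    using that
  proof (induction rule: trancl_induct)
    case (base y)
    then show ?case using P(1) Q(1) by auto
  next
    case (step y z)
    then show ?case using P(1) Q(1) dis by (auto intro: trancl_into_trancl)
  qed
  have "acyclic (P \<union> Q)" using E P(3) Q(3) unfolding acyclic_def by blast
  moreover have "single_valued (P \<union> Q)"
    using P(1,2) Q(1,2) dis unfolding single_valued_def by blast
  ultimately have "rooted_forest (A \<union> B) (P \<union> Q)"
    using P(1) Q(1) unfolding rooted_forest_def by auto
  moreover have "forest_depth_less (A \<union> B) (P \<union> Q) d"
    unfolding forest_depth_less_def forest_roots_def
  proof
    fix x assume "x \<in> A \<union> B"
    then show "\<exists>r\<in>A \<union> B - Domain (P \<union> Q). \<exists>n<d. (x, r) \<in> (P \<union> Q) ^^ n"
    proof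
      assume "x \<in> A"
      from Pd[OF this] obtain r n where r: "r \<in> A - Domain P" "n < d" "(x, r) \<in> P ^^ n" by blast
      moreover have "r \<in> A \<union> B - Domain (P \<union> Q)" using r Q(1) dis by auto
      ultimately show ?thesis using relpow_subset_mono[of P "P \<union> Q"] by blast
    next
      assume "x \<in> B"
      from Qd[OF this] obtain r n where r: "r \<in> B - Domain Q" "n < d" "(x, r) \<in> Q ^^ n" by blast
      moreover have "r \<in> A \<union> B - Domain (P \<union> Q)" using r P(1) dis by auto
      ultimately show ?thesis using relpow_subset_mono[of Q "P \<union> Q"] by blast
    qed
  qed
  moreover have "(x, y) \<in> (P \<union> Q)\<^sup>+ \<or> (y, x) \<in> (P \<union> Q)\<^sup>+"
    if "x \<in> A \<union> B" "y \<in> A \<union> B" "R x y" for x y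
    using that Pa[of x y] Qa[of x y] union.hyps(4)[of x y] union.hyps(4)[of y x]
      trancl_mono[of _ P "P \<union> Q"] trancl_mono[of _ Q "P \<union> Q"] by blast
  ultimately show ?case by blast
qed

lemma treedepth_le:
  assumes G: "simple_graph G" and td: "td_at_most (\<lambda>x y. {x, y} \<in> edges G) (verts G) d"
  shows "treedepth G \<le> d"
proof -
  have ends: "x \<in> verts G \<and> y \<in> verts G \<and> x \<noteq> y" if "{x, y} \<in> edges G" for x y
    using G that unfolding simple_graph_def by fastforce
  obtain P where "rooted_forest (verts G) P" "forest_depth_less (verts G) P d"
    "\<forall>x\<in>verts G. \<forall>y\<in>verts G. {x, y} \<in> edges G \<longrightarrow> (x, y) \<in> P\<^sup>+ \<or> (y, x) \<in> P\<^sup>+"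
    using td_at_most_forest[OF td] ends by blast
  then show ?thesis
    unfolding treedepth_def ancestor_closed_def by (intro Least_le) (use ends in blast)
qed

section \<open>Deletions along a noncrossing order\<close>

lemma finite_nat_set_enumeration:
  fixes S :: "nat set"
  assumes "finite S"
  obtains s where "\<And>u w. u < w \<Longrightarrow> w < card S \<Longrightarrow> s u < s w" "s ` {..<card S} = S"
proof
  let ?xs = "sorted_list_of_set S"
  show "?xs ! u < ?xs ! w" if "u < w" "w < card S" for u w
    using strict_sorted_list_of_set[of S] assms that by (auto simp: sorted_wrt_iff_nth_less)
  show "(!) ?xs ` {..<card S} = S"
    using assms nth_image[of "length ?xs" ?xs] by (simp add: lessThan_atLeast0)
qed

text \<open>The interval has end points \<open>s 0\<close> and \<open>s K\<close>; the chain
  vertices inside it are the \<open>s u\<close> with \<open>0 < u < K\<close>. By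
  \<open>separates\<close>, no edge within the open interval passes over a chain vertex, while edges
  at the two end points may do so. By \<open>gap_closed\<close>, each gap satisfies the same closure
  condition as the whole interval, which allows recursion; by \<open>gap_inside\<close>, gap
  vertices are not adjacent to \<open>s 0\<close> or \<open>s K\<close>.\<close>

locale separating_chain =
  fixes R :: "nat \<Rightarrow> nat \<Rightarrow> bool" and K :: nat and s :: "nat \<Rightarrow> nat"
  assumes R_sym: "R x y \<Longrightarrow> R y x"
    and K_pos: "0 < K"
    and s_less: "u < w \<Longrightarrow> w \<le> K \<Longrightarrow> s u < s w"
    and separates: "0 < u \<Longrightarrow> u < K \<Longrightarrow> s 0 < x \<Longrightarrow> x < s u \<Longrightarrow> s u < y \<Longrightarrow> y < s K \<Longrightarrow> \<not> R x y"
    and gap_closed: "u < K \<Longrightarrow> s u < x \<Longrightarrow> x < s (Suc u) \<Longrightarrow> R x y \<Longrightarrow> s u \<le> y \<and> y \<le> s (Suc u)"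
    and gap_inside: "u < K \<Longrightarrow> s u < x \<Longrightarrow> x < s (Suc u) \<Longrightarrow> R x y \<Longrightarrow> s 0 < y \<and> y < s K"
begin

definition gap :: "nat \<Rightarrow> nat set" where "gap u = {s u<..<s (Suc u)}"

lemma s_le: "u \<le> w \<Longrightarrow> w \<le> K \<Longrightarrow> s u \<le> s w"
  using s_less by (metis le_neq_implies_less less_imp_le order_refl)

lemma s_inj: "u \<le> K \<Longrightarrow> w \<le> K \<Longrightarrow> s u = s w \<Longrightarrow> u = w"
  using s_less by (metis linorder_less_linear nless_le)

lemma gap_not_s: "x \<in> gap u \<Longrightarrow> u < K \<Longrightarrow> w \<le> K \<Longrightarrow> x \<noteq> s w"
  using s_le[of w u] s_le[of "Suc u" w] unfolding gap_def by (cases "w \<le> u") auto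

lemma gap_unique: "x \<in> gap u \<Longrightarrow> x \<in> gap w \<Longrightarrow> u < K \<Longrightarrow> w < K \<Longrightarrow> u = w"
  using s_le[of "Suc u" w] s_le[of "Suc w" u] unfolding gap_def
  by (cases u w rule: linorder_cases) auto

lemma gap_bounds: "x \<in> gap u \<Longrightarrow> u < K \<Longrightarrow> s 0 < x \<and> x < s K"
  using s_le[of 0 u] s_le[of "Suc u" K] unfolding gap_def by auto

lemma cover_cases:
  assumes "s 0 < x" "x < s K"
  obtains u where "0 < u" "u < K" "x = s u" | u where "u < K" "x \<in> gap u"
proof -
  define u where "u = Max {u. u < K \<and> s u \<le> x}"
  have u: "u < K \<and> s u \<le> x"
    using Max_in[of "{u. u < K \<and> s u \<le> x}"] assms K_pos unfolding u_def by fastforce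
  have "x < s (Suc u)"
  proof (rule ccontr)
    assume n: "\<not> x < s (Suc u)"
    then have "Suc u \<noteq> K" using assms by auto
    then have "Suc u \<le> u"
      unfolding u_def by (intro Max_ge) (use n u in \<open>auto simp: u_def\<close>)
    then show False by simp
  qed
  then show ?thesis
    using that u assms unfolding gap_def by (cases "x = s u"; cases "u = 0") auto
qed

lemma distinct_gaps:
  assumes "x \<in> gap u" "y \<in> gap w" "u < K" "w < K" "u \<noteq> w"
  shows "x \<noteq> y \<and> \<not> R x y"
proof -
  have "y \<notin> gap u" using gap_unique[of y u w] assms by auto
  moreover have "y \<noteq> s u" "y \<noteq> s (Suc u)" using gap_not_s[OF assms(2,4)] assms by auto
  moreover have "x \<noteq> y" using \<open>y \<notin> gap u\<close> assms by auto
  ultimately show ?thesis using gap_closed[of u x y] assms unfolding gap_def by auto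
qed

lemma td_at_most_UN_gaps:
  assumes "\<And>u. u < K \<Longrightarrow> B u \<subseteq> gap u" "\<And>u. u < K \<Longrightarrow> td_at_most R (B u) d"
  shows "td_at_most R (\<Union>u<K. B u) d"
proof (rule td_at_most_UN)
  show "x \<noteq> y \<and> \<not> R x y" if "i \<in> {..<K}" "j \<in> {..<K}" "i \<noteq> j" "x \<in> B i" "y \<in> B j" for i j x y
    using distinct_gaps[of x i y j] assms(1) that by blast
qed (use assms in auto)

lemma td_at_most_join:
  assumes "0 < m" "m < K" "A \<subseteq> {s 0<..<s K}"
    and "td_at_most R (A \<inter> {s u<..<s m}) d" "td_at_most R (A \<inter> {s m<..<s w}) d"
  shows "td_at_most R ((A \<inter> {s u<..<s m}) \<union> (A \<inter> {s m<..<s w})) d"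
proof (rule td_at_most.union)
  show "\<not> R x y \<and> \<not> R y x" if "x \<in> A \<inter> {s u<..<s m}" "y \<in> A \<inter> {s m<..<s w}" for x y
  proof -
    have "\<not> R x y" by (rule separates[of m]) (use assms that in auto)
    then show ?thesis using R_sym by blast
  qed
qed (use assms in auto)

text \<open>Bisection: the middle chain vertex costs one unit, and once it is removed the two halves
  have no edge between them, so they share the bound. Thus \<open>2 ^ k\<close> consecutive gaps
  cost only \<open>k\<close> more than a single gap.\<close>

lemma td_at_most_block:
  assumes gaps: "\<And>u. u < K \<Longrightarrow> td_at_most R (A \<inter> gap u) d" and A: "A \<subseteq> {s 0<..<s K}"
  shows "u < w \<Longrightarrow> w \<le> K \<Longrightarrow> w - u \<le> 2 ^ k \<Longrightarrow> td_at_most R (A \<inter> {s u<..<s w}) (d + k)"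
proof (induction k arbitrary: u w)
  case 0
  then have "w = Suc u" by auto
  then show ?case using gaps[of u] 0 by (simp add: gap_def)
next
  case (Suc k)
  show ?case
  proof (cases "w = Suc u")
    case True
    then have "td_at_most R (A \<inter> {s u<..<s w}) d" using gaps[of u] Suc.prems by (simp add: gap_def)
    then show ?thesis by (rule td_at_most_mono) auto
  next
    case False
    define m where "m = u + (w - u) div 2"
    have m: "u < m" "m < w" "m - u \<le> 2 ^ k" "w - m \<le> 2 ^ k"
      using Suc.prems False unfolding m_def by auto
    let ?Z = "(A \<inter> {s u<..<s m}) \<union> (A \<inter> {s m<..<s w})"
    have "td_at_most R ?Z (d + k)"
      using m Suc.prems A by (intro td_at_most_join Suc.IH) auto
    then have "td_at_most R (insert (s m) ?Z - {s m}) (d + k)"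
      by (rule td_at_most_mono) auto
    then have "td_at_most R (insert (s m) ?Z) (Suc (d + k))"
      by (intro td_at_most.remove[of "s m"]) auto
    then show ?thesis by (rule td_at_most_mono) (auto simp: not_less)
  qed
qed

text \<open>A deleted chain vertex splits the block at no cost. After splitting at every index
  congruent to \<open>i\<close>, only blocks of at most \<open>M\<close> gaps remain, and these are
  bisected.\<close>

lemma td_at_most_periodic:
  assumes gaps: "\<And>u. u < K \<Longrightarrow> td_at_most R (A \<inter> gap u) d" and A: "A \<subseteq> {s 0<..<s K}"
    and i: "i < M" "M \<le> 2 ^ k" and deleted: "\<And>m. 0 < m \<Longrightarrow> m < K \<Longrightarrow> m mod M = i \<Longrightarrow> s m \<notin> A"
  shows "u < w \<Longrightarrow> w \<le> K \<Longrightarrow> td_at_most R (A \<inter> {s u<..<s w}) (d + k)"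
proof (induction "w - u" arbitrary: u w rule: less_induct)
  case less
  show ?case
  proof (cases "\<exists>m. u < m \<and> m < w \<and> m mod M = i")
    case True
    then obtain m where m: "u < m" "m < w" "m mod M = i" by blast
    then have "s m \<notin> A" using deleted less.prems by auto
    then have "A \<inter> {s u<..<s w} \<subseteq> (A \<inter> {s u<..<s m}) \<union> (A \<inter> {s m<..<s w})"
      by (auto simp: not_less order_le_less)
    moreover have "td_at_most R ((A \<inter> {s u<..<s m}) \<union> (A \<inter> {s m<..<s w})) (d + k)"
      using m less.prems A by (intro td_at_most_join less.hyps) auto
    ultimately show ?thesis using td_at_most_mono by blast
  next
    case False
    have "w - u \<le> M"
    proof (rule ccontr)
      assume n: "\<not> w - u \<le> M"
      \<comment> \<open>\<open>e\<close> is the distance from \<open>Suc u\<close> to the next index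
        congruent to \<open>i\<close>; adding \<open>M\<close> before subtracting avoids truncation.
        As \<open>e < M\<close>, that index is at most \<open>u + M\<close>, hence below
        \<open>w\<close>.\<close>
      define e where "e = (i + M - Suc u mod M) mod M"
      have "e < M" using i by (simp add: e_def)
      have "(Suc u + e) mod M = (Suc u mod M + (i + M - Suc u mod M)) mod M"
        unfolding e_def by (simp only: mod_simps)
      also have "Suc u mod M + (i + M - Suc u mod M) = i + M"
        using mod_less_divisor[of M "Suc u"] i by linarith
      finally have "(Suc u + e) mod M = i" using i by simp
      moreover have "u < Suc u + e" "Suc u + e < w" using n \<open>e < M\<close> by auto
      ultimately show False using False by blast
    qed
    then show ?thesis using td_at_most_block[OF gaps A] less.prems i by simp
  qed
qed

end

text \<open>The chain consists of all neighbours of \<open>l\<close> and \<open>r\<close> inside the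
  interval. Every vertex of a gap is then a non-neighbour of both end points. The bound
  \<open>1 < K\<close> says that the chain has an inner vertex, so every gap is shorter than the
  interval.\<close>

lemma separating_chain_exists:
  fixes R :: "nat \<Rightarrow> nat \<Rightarrow> bool" and l r :: nat
  assumes sym: "\<And>x y. R x y \<Longrightarrow> R y x"
    and noncrossing: "\<And>a b c d. a < b \<Longrightarrow> b < c \<Longrightarrow> c < d \<Longrightarrow> R a c \<Longrightarrow> \<not> R b d"
    and inside: "\<And>x y. l < x \<Longrightarrow> x < r \<Longrightarrow> R x y \<Longrightarrow> l \<le> y \<and> y \<le> r"
    and lr: "Suc l < r"
  obtains K s where "separating_chain R K s" "s 0 = l" "s K = r" "1 < K"
proof -
  \<comment> \<open>\<open>Suc l\<close> is added only to make the recursion progress when \<open>l\<close> and \<open>r\<close> have no neighbours inside.\<close>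
  define S where "S = {s. l < s \<and> s < r \<and> (R l s \<or> R r s \<or> s = Suc l)}"
  have finS: "finite S" unfolding S_def by auto
  have "S \<noteq> {}" using lr by (auto simp: S_def)
  define K where "K = Suc (card S)"
  have K1: "1 < K" using finS \<open>S \<noteq> {}\<close> by (simp add: K_def card_gt_0_iff)
  have "l \<notin> insert r S" "r \<notin> S" using lr by (auto simp: S_def)
  then have "card (insert l (insert r S)) = Suc K" using finS by (simp add: K_def)
  then obtain s where smono: "\<And>u w. u < w \<Longrightarrow> w \<le> K \<Longrightarrow> s u < s w"
    and simg: "s ` {..K} = insert l (insert r S)"
    using finite_nat_set_enumeration[of "insert l (insert r S)"] finS
    by (metis finite_insert less_Suc_eq_le lessThan_Suc_atMost)
  have s_mem: "s u \<in> insert l (insert r S)" if "u \<le> K" for u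
    using simg that by auto
  have range: "l \<le> s u \<and> s u \<le> r" if "u \<le> K" for u
    using s_mem[OF that] lr by (auto simp: S_def)
  have s_le: "s u \<le> s w" if "u \<le> w" "w \<le> K" for u w
    using smono[of u w] that by (cases "u = w") auto
  obtain u where "u \<le> K" "s u = l" using simg by (metis atMost_iff imageE insertI1)
  then have s0: "s 0 = l" using s_le[of 0 u] range[of 0] by auto
  obtain u where "u \<le> K" "s u = r" using simg by (metis atMost_iff imageE insertI1 insertI2)
  then have sK: "s K = r" using s_le[of u K] range[of K] by auto
  \<comment> \<open>An edge over \<open>s u\<close> would cross the edge from \<open>s u\<close> to
    \<open>l\<close> or \<open>r\<close>. In the remaining case \<open>s u = Suc l\<close> there is
    no \<open>x\<close> with \<open>l < x < s u\<close>.\<close>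
  have separates: "\<not> R x y" if u: "0 < u" "u < K" and xy: "l < x" "x < s u" "s u < y" "y < r" for u x y
  proof -
    have "l < s u" "s u < r" using smono[of 0 u] smono[of u K] u s0 sK by auto
    then have "R l (s u) \<or> R r (s u) \<or> s u = Suc l" using s_mem[of u] u by (auto simp: S_def)
    then show ?thesis
      using noncrossing[of l x "s u" y] noncrossing[of x "s u" y r] xy sym by auto
  qed
  have not_S: "x \<notin> S" if "u < K" "s u < x" "x < s (Suc u)" for u x
  proof
    assume "x \<in> S"
    then obtain w where w: "w \<le> K" "x = s w" using simg by (metis atMost_iff imageE insertI2)
    then show False using that s_le[of w u] s_le[of "Suc u" w] by (cases "w \<le> u") auto
  qed
  have gap: "l < x" "x < r" if "u < K" "s u < x" "x < s (Suc u)" for u x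
    using range[of u] range[of "Suc u"] that by auto
  have inner: "l < y \<and> y < r" if u: "u < K" "s u < x" "x < s (Suc u)" and "R x y" for u x y
  proof -
    have "y \<noteq> l" "y \<noteq> r" using not_S[OF u] gap[OF u] sym \<open>R x y\<close> unfolding S_def by auto
    then show ?thesis using inside[of x y] gap[OF u] \<open>R x y\<close> by auto
  qed
  have "separating_chain R K s"
  proof
    \<comment> \<open>An edge leaving the gap passes over \<open>s u\<close> or
      \<open>s (Suc u)\<close>. By \<open>inner\<close> its far end is strictly between
      \<open>l\<close> and \<open>r\<close>, so the vertex passed over is an inner chain vertex and
      \<open>separates\<close> applies.\<close>
    show "s u \<le> y \<and> y \<le> s (Suc u)" if u: "u < K" "s u < x" "x < s (Suc u)" and "R x y" for u x y
    proof (rule ccontr)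
      assume "\<not> (s u \<le> y \<and> y \<le> s (Suc u))"
      then consider "y < s u" | "s (Suc u) < y" by linarith
      then show False
      proof cases
        case 1
        moreover have "0 < u" using 1 inner[OF u \<open>R x y\<close>] s0 by (cases u) auto
        ultimately show False
          using separates[of u y x] inner[OF u \<open>R x y\<close>] gap[OF u] u sym \<open>R x y\<close> by auto
      next
        case 2
        moreover have "Suc u \<noteq> K" using 2 inner[OF u \<open>R x y\<close>] sK by auto
        ultimately show False
          using separates[of "Suc u" x y] inner[OF u \<open>R x y\<close>] gap[OF u] u \<open>R x y\<close> by auto
      qed
    qed
  qed (use sym K1 smono separates inner s0 sK in auto)
  then show ?thesis using that s0 sK K1 by blast
qed

section \<open>The recursive deletion\<close>

text \<open>\<open>A\<close> collects the vertices above the first fully deleted level, \<open>B\<close> those below it.\<close>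

definition splits_off :: "('a \<Rightarrow> 'a \<Rightarrow> bool) \<Rightarrow> 'a set \<Rightarrow> 'a set \<Rightarrow> nat \<Rightarrow> nat \<Rightarrow> bool" where
  "splits_off R I W d e \<longleftrightarrow> (\<exists>A B. A \<union> B = W \<and> A \<inter> B = {} \<and>
     (\<forall>x\<in>A. \<forall>y\<in>B. \<not> R x y) \<and> (\<forall>x\<in>B. \<forall>y. R x y \<longrightarrow> y \<in> I) \<and>
     td_at_most R A d \<and> td_at_most R B e)"

lemma splits_offI:
  assumes "A \<union> B = W" "\<And>x y. x \<in> A \<Longrightarrow> y \<in> B \<Longrightarrow> \<not> R x y \<and> x \<noteq> y"
    and "\<And>x y. x \<in> B \<Longrightarrow> R x y \<Longrightarrow> y \<in> I" "td_at_most R A d" "td_at_most R B e"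
  shows "splits_off R I W d e"
  unfolding splits_off_def using assms by (intro exI[of _ A] exI[of _ B]) blast

text \<open>Each level is deleted for at most one choice of \<open>i\<close>: two such choices would
  differ by a positive multiple of \<open>M\<close> smaller than \<open>M\<close>.\<close>

lemma card_residue_le_1: "card {i. i < M \<and> (i + c) mod M = (0::nat)} \<le> 1" (is "card ?Z \<le> 1")
proof -
  have less: "\<not> i < j" if "j < M" "(i + c) mod M = 0" "(j + c) mod M = 0" for i j
  proof
    assume "i < j"
    have "M dvd (j + c) - (i + c)" using that by (intro dvd_diff_nat) auto
    then show False using \<open>i < j\<close> \<open>j < M\<close> by (auto dest: dvd_imp_le)
  qed
  have "i = j" if "i < M" "j < M" "(i + c) mod M = 0" "(j + c) mod M = 0" for i j
    using less[of j i] less[of i j] that by simp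
  then have "i = j" if "i \<in> ?Z" "j \<in> ?Z" for i j
    using that unfolding mem_Collect_eq by (elim conjE)
  then have "\<forall>i\<in>?Z. \<forall>j\<in>?Z. i = j" by (intro ballI)
  moreover have "finite ?Z" by simp
  ultimately show ?thesis unfolding One_nat_def by (simp only: card_le_Suc0_iff_eq)
qed

context separating_chain
begin

text \<open>The chain vertices have level \<open>- c\<close> modulo \<open>M\<close>; each recursive step replaces \<open>c\<close> by
  \<open>c + (M - 1)\<close>, that is, \<open>c - 1\<close> without truncated subtraction.\<close>

definition chain_deletion :: "nat \<Rightarrow> nat \<Rightarrow> (nat \<Rightarrow> nat \<Rightarrow> nat set) \<Rightarrow> nat \<Rightarrow> nat set" where
  "chain_deletion M c Yg i = {x. \<exists>u<K. x \<in> gap u \<and> x \<in> Yg u i} \<union>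
     {x. \<exists>u. 0 < u \<and> u < K \<and> x = s u \<and> ((i + c) mod M = 0 \<or> u mod M = i)}"

lemma chain_deletion_gap:
  assumes "x \<in> gap u" "u < K"
  shows "x \<in> chain_deletion M c Yg i \<longleftrightarrow> x \<in> Yg u i"
proof -
  have "w = u" if "x \<in> gap w" "w < K" for w using gap_unique that assms by metis
  moreover have "x \<noteq> s w" if "w < K" for w using gap_not_s[OF assms] that by auto
  ultimately show ?thesis unfolding chain_deletion_def using assms by blast
qed

lemma chain_deletion_s:
  assumes "0 < u" "u < K"
  shows "s u \<in> chain_deletion M c Yg i \<longleftrightarrow> (i + c) mod M = 0 \<or> u mod M = i"
proof
  assume "s u \<in> chain_deletion M c Yg i"
  then consider w where "w < K" "s u \<in> gap w"
    | w where "w < K" "s u = s w" "(i + c) mod M = 0 \<or> w mod M = i"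
    unfolding chain_deletion_def by auto
  then show "(i + c) mod M = 0 \<or> u mod M = i"
  proof cases
    case 1
    then show ?thesis using gap_not_s[of "s u" w u] assms by auto
  next
    case 2
    then have "w = u" using s_inj[of w u] assms by auto
    then show ?thesis using 2 by simp
  qed
next
  assume "(i + c) mod M = 0 \<or> u mod M = i"
  then show "s u \<in> chain_deletion M c Yg i"
    using assms unfolding chain_deletion_def by (intro UnI2 CollectI exI[of _ u] conjI) simp_all
qed

text \<open>A chain vertex is deleted for at most one \<open>i\<close> because of its level and at
  most one because of its index. A gap vertex is subject only to the deletion inside its gap, so the
  bound 2 does not grow with the depth of the recursion.\<close>

lemma chain_deletion_card:
  assumes Yg: "\<And>u v. u < K \<Longrightarrow> card {i. i < M \<and> v \<in> Yg u i} \<le> 2"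
  shows "card {i. i < M \<and> v \<in> chain_deletion M c Yg i} \<le> 2"
proof -
  consider u where "u < K" "v \<in> gap u" | u where "0 < u" "u < K" "v = s u"
    | "\<And>i. v \<notin> chain_deletion M c Yg i"
    unfolding chain_deletion_def by blast
  then show ?thesis
  proof cases
    case 1
    then show ?thesis using Yg[OF 1(1), of v] chain_deletion_gap[OF 1(2,1)] by simp
  next
    case 2
    let ?Z = "{i. i < M \<and> (i + c) mod M = 0}"
    have "{i. i < M \<and> v \<in> chain_deletion M c Yg i} \<subseteq> insert (u mod M) ?Z"
      unfolding 2(3) chain_deletion_s[OF 2(1,2)] by blast
    then have "card {i. i < M \<and> v \<in> chain_deletion M c Yg i} \<le> card (insert (u mod M) ?Z)"
      by (intro card_mono) auto
    also have "\<dots> \<le> Suc (card ?Z)" by (rule card_insert_le_m1) auto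
    also have "\<dots> \<le> 2" using card_residue_le_1[of M c] by simp
    finally show ?thesis .
  qed simp
qed

text \<open>The residue \<open>(i + c) mod M\<close> counts the levels from the present chain down
  to the first fully deleted one, and each of them costs \<open>k\<close>. Below a fully deleted
  level at most \<open>M - 1\<close> levels survive before the next one, whence the bound
  \<open>(M - 1) * k\<close> for the lower part. The lower parts of the gaps have all their
  neighbours inside their own gap, so they never interact with chain vertices or with other
  gaps.\<close>

lemma chain_deletion_splits:
  assumes i: "i < M" and M: "M \<le> 2 ^ k"
    and Yg: "\<And>u. u < K \<Longrightarrow> splits_off R (gap u) (gap u - Yg u i) (((i + (c + (M - 1))) mod M) * k) ((M - 1) * k)"
  shows "splits_off R {s 0<..<s K} ({s 0<..<s K} - chain_deletion M c Yg i) (((i + c) mod M) * k) ((M - 1) * k)"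
proof -
  define d where "d = ((i + (c + (M - 1))) mod M) * k"
  define e where "e = (M - 1) * k"
  let ?Y = "chain_deletion M c Yg i"
  have "\<forall>u. \<exists>AB. u < K \<longrightarrow> fst AB \<union> snd AB = gap u - Yg u i \<and> fst AB \<inter> snd AB = {} \<and>
     (\<forall>x\<in>fst AB. \<forall>y\<in>snd AB. \<not> R x y) \<and> (\<forall>x\<in>snd AB. \<forall>y. R x y \<longrightarrow> y \<in> gap u) \<and>
     td_at_most R (fst AB) d \<and> td_at_most R (snd AB) e"
    using Yg unfolding splits_off_def d_def e_def by auto
  from choice[OF this] obtain AB where AB: "\<And>u. u < K \<Longrightarrow>
     fst (AB u) \<union> snd (AB u) = gap u - Yg u i \<and> fst (AB u) \<inter> snd (AB u) = {} \<and>
     (\<forall>x\<in>fst (AB u). \<forall>y\<in>snd (AB u). \<not> R x y) \<and> (\<forall>x\<in>snd (AB u). \<forall>y. R x y \<longrightarrow> y \<in> gap u) \<and>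
     td_at_most R (fst (AB u)) d \<and> td_at_most R (snd (AB u)) e"
    by blast
  define Ag Bg where "Ag u = fst (AB u)" and "Bg u = snd (AB u)" for u
  have gap_eq: "Ag u \<union> Bg u = gap u - Yg u i" and gap_disj: "Ag u \<inter> Bg u = {}"
    and td_A: "td_at_most R (Ag u) d" and td_B: "td_at_most R (Bg u) e" if "u < K" for u
    using AB[OF that] unfolding Ag_def Bg_def by blast+
  have gap_AB: "\<not> R x y" if "u < K" "x \<in> Ag u" "y \<in> Bg u" for u x y
    using AB[OF that(1)] that(2,3) unfolding Ag_def Bg_def by blast
  have gap_B: "y \<in> gap u" if "u < K" "x \<in> Bg u" "R x y" for u x y
    using AB[OF that(1)] that(2,3) unfolding Ag_def Bg_def by blast
  have A_gap: "Ag u \<subseteq> gap u" and B_gap: "Bg u \<subseteq> gap u" if "u < K" for u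
    using gap_eq[OF that] by auto
  let ?A = "\<Union>u<K. Ag u" and ?B = "\<Union>u<K. Bg u"
  have AB_iff: "x \<in> Ag u \<or> x \<in> Bg u \<longleftrightarrow> x \<notin> ?Y" if "x \<in> gap u" "u < K" for x u
    using gap_eq[OF that(2)] chain_deletion_gap[OF that] that by blast
  have td_UB: "td_at_most R ?B e" by (rule td_at_most_UN_gaps[OF B_gap td_B])
  have B_out: "y \<in> {s 0<..<s K}" if xy: "x \<in> ?B" "R x y" for x y
  proof -
    obtain u where u: "u < K" "x \<in> Bg u" using xy by blast
    show ?thesis using gap_bounds[OF gap_B[OF u xy(2)] u(1)] by simp
  qed
  have AB_sep: "\<not> R x y \<and> x \<noteq> y" if xy: "x \<in> ?A" "y \<in> ?B" for x y
  proof -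
    obtain u w where u: "u < K" "x \<in> Ag u" and w: "w < K" "y \<in> Bg w" using xy by blast
    show ?thesis
    proof (cases "u = w")
      case True
      then show ?thesis using gap_AB[of u x y] gap_disj[of u] u w by auto
    next
      case False
      then show ?thesis using distinct_gaps[of x u y w] A_gap[of u] B_gap[of w] u w by auto
    qed
  qed
  \<comment> \<open>One level down, the residue drops by one, and 0 wraps around to
    \<open>M - 1\<close>. So if the present chain is deleted, the upper parts of the gaps already
    have the bound \<open>e\<close> of the lower parts.\<close>
  have i_cases: "(i + c) mod M = 0 \<and> d = e \<or> (\<exists>t. (i + c) mod M = Suc t \<and> d = t * k)"
  proof -
    have "(i + (c + (M - 1))) mod M = ((i + c) mod M + (M - 1)) mod M"
      by (metis add.assoc mod_add_left_eq)
    then have shift: "d = (((i + c) mod M + (M - 1)) mod M) * k" by (simp only: d_def)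
    have less: "(i + c) mod M < M" using i by simp
    show ?thesis
    proof (cases "(i + c) mod M")
      case 0
      then show ?thesis using shift i by (simp add: e_def)
    next
      case (Suc t)
      then have "(i + c) mod M + (M - 1) = t + M" using i by simp
      then have "d = t * k" using shift less Suc by simp
      then show ?thesis using Suc by blast
    qed
  qed
  show ?thesis
  proof (cases "(i + c) mod M = 0")
    \<comment> \<open>The present chain is the first fully deleted level. Hence the upper part is
      empty, and everything that survives in the gaps goes into the lower part.\<close>
    case True
    then have "d = e" using i_cases by auto
    have td_UA: "td_at_most R ?A e"
      unfolding \<open>d = e\<close>[symmetric] by (rule td_at_most_UN_gaps[OF A_gap td_A])
    have td_U: "td_at_most R (?A \<union> ?B) e"
      using td_UA td_UB AB_sep R_sym by (intro td_at_most.union) blast+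
    have U_eq: "?A \<union> ?B = {s 0<..<s K} - ?Y"
    proof (intro equalityI subsetI)
      fix x assume "x \<in> ?A \<union> ?B"
      then obtain u where u: "u < K" "x \<in> Ag u \<or> x \<in> Bg u" by blast
      then have "x \<in> gap u" using A_gap B_gap by blast
      then show "x \<in> {s 0<..<s K} - ?Y" using AB_iff[of x u] gap_bounds u by simp
    next
      fix x assume x: "x \<in> {s 0<..<s K} - ?Y"
      then have "s 0 < x" "x < s K" by auto
      then show "x \<in> ?A \<union> ?B"
      proof (cases rule: cover_cases)
        case (1 u) then show ?thesis using chain_deletion_s[of u] x True by simp
      next
        case (2 u) then show ?thesis using AB_iff[of x u] x by blast
      qed
    qed
    have U_out: "y \<in> {s 0<..<s K}" if xy: "x \<in> ?A \<union> ?B" "R x y" for x y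
    proof -
      obtain u where "u < K" "x \<in> gap u" using A_gap B_gap xy(1) by blast
      then show ?thesis using gap_inside[of u x y] xy(2) unfolding gap_def by auto
    qed
    show ?thesis
      unfolding e_def[symmetric]
    proof (rule splits_offI[of "{}" "?A \<union> ?B"])
      show "{} \<union> (?A \<union> ?B) = {s 0<..<s K} - ?Y" using U_eq by simp
    qed (use U_out td_U in \<open>blast intro: td_at_most.empty\<close>)+
  next
    case False
    then obtain t where t: "(i + c) mod M = Suc t" "d = t * k" using i_cases by auto
    \<comment> \<open>The surviving chain vertices join the upper parts of the gaps. Periodic
      bisection along the chain then raises the bound from \<open>t * k\<close> to
      \<open>Suc t * k\<close>.\<close>
    define A where "A = ?A \<union> {x. \<exists>u. 0 < u \<and> u < K \<and> x = s u \<and> u mod M \<noteq> i}"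
    have A_cases: "(\<exists>u<K. x \<in> Ag u \<and> x \<in> gap u) \<or> (\<exists>u. 0 < u \<and> u < K \<and> x = s u \<and> u mod M \<noteq> i)"
      if "x \<in> A" for x
      using that A_gap unfolding A_def by blast
    have A_sub: "A \<subseteq> {s 0<..<s K}"
    proof
      fix x assume "x \<in> A"
      from A_cases[OF this] show "x \<in> {s 0<..<s K}"
        using gap_bounds[of x] s_less[of 0] s_less[of _ K] by auto
    qed
    have A_gap_eq: "A \<inter> gap u = Ag u" if u: "u < K" for u
    proof (intro equalityI subsetI)
      fix x assume x: "x \<in> A \<inter> gap u"
      then consider w where "w < K" "x \<in> Ag w" "x \<in> gap w" | w where "w < K" "x = s w"
        using A_cases[of x] by auto
      then show "x \<in> Ag u"
      proof cases
        case 1 then show ?thesis using gap_unique[of x w u] x u by auto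
      next
        case 2 then show ?thesis using gap_not_s[of x u w] x u by auto
      qed
    qed (use A_gap u in \<open>auto simp: A_def\<close>)
    have s_notin: "s m \<notin> A" if m: "0 < m" "m < K" "m mod M = i" for m
    proof
      assume "s m \<in> A"
      from A_cases[OF this] consider u where "u < K" "s m \<in> gap u"
        | u where "u < K" "s m = s u" "u mod M \<noteq> i" by auto
      then show False
      proof cases
        case 1 then show ?thesis using gap_not_s[of "s m" u m] m by simp
      next
        case 2 then show ?thesis using s_inj[of m u] m by simp
      qed
    qed
    have "td_at_most R (A \<inter> {s 0<..<s K}) (d + k)"
      using A_gap_eq td_A K_pos by (intro td_at_most_periodic[OF _ A_sub i M s_notin]) auto
    moreover have "A \<inter> {s 0<..<s K} = A" using A_sub by auto
    moreover have "d + k = ((i + c) mod M) * k" using t by simp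
    ultimately have "td_at_most R A (((i + c) mod M) * k)" by simp
    moreover have "\<not> R x y \<and> x \<noteq> y" if xy: "x \<in> A" "y \<in> ?B" for x y
    proof (cases "x \<in> ?A")
      case True
      then show ?thesis using AB_sep xy by blast
    next
      case False
      obtain w where w: "w < K" "y \<in> Bg w" using xy by blast
      obtain u where u: "u < K" "x = s u" using xy(1) False unfolding A_def by blast
      then have "x \<notin> gap w" using gap_not_s[of x w u] w by auto
      then show ?thesis using gap_B[OF w] B_gap[OF w(1)] w(2) R_sym by blast
    qed
    moreover have "A \<union> ?B = {s 0<..<s K} - ?Y"
    proof (intro equalityI subsetI)
      fix x assume "x \<in> A \<union> ?B"
      then consider u where "u < K" "x \<in> Ag u \<or> x \<in> Bg u" | u where "0 < u" "u < K" "x = s u" "u mod M \<noteq> i"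
        unfolding A_def by blast
      then show "x \<in> {s 0<..<s K} - ?Y"
      proof cases
        case 1
        then have "x \<in> gap u" using A_gap B_gap by blast
        then show ?thesis using AB_iff[of x u] gap_bounds 1 by simp
      next
        case 2
        then show ?thesis using chain_deletion_s[of u] False s_less[of 0 u] s_less[of u K] by simp
      qed
    next
      fix x assume x: "x \<in> {s 0<..<s K} - ?Y"
      then have "s 0 < x" "x < s K" by auto
      then show "x \<in> A \<union> ?B"
      proof (cases rule: cover_cases)
        case (1 u)
        then have "u mod M \<noteq> i" using chain_deletion_s[of u] x by auto
        then show ?thesis using 1 unfolding A_def by blast
      next
        case (2 u) then show ?thesis using AB_iff[of x u] x unfolding A_def by blast
      qed
    qed
    ultimately show ?thesis
      unfolding e_def[symmetric] using td_UB B_out by (intro splits_offI[of A ?B])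
  qed
qed

end

text \<open>Induction on the length of the interval, with the level offset \<open>c\<close>
  arbitrary because it changes from level to level. The sets \<open>Y i\<close> are produced for all
  \<open>i\<close> at once, since the bound 2 counts the values of \<open>i\<close> that delete a
  given vertex.\<close>

lemma interval_deletion:
  fixes R :: "nat \<Rightarrow> nat \<Rightarrow> bool" and M k c l r :: nat
  assumes sym: "\<And>x y. R x y \<Longrightarrow> R y x"
    and noncrossing: "\<And>a b c d. a < b \<Longrightarrow> b < c \<Longrightarrow> c < d \<Longrightarrow> R a c \<Longrightarrow> \<not> R b d"
    and M: "M \<le> 2 ^ k"
    and inside: "\<And>x y. l < x \<Longrightarrow> x < r \<Longrightarrow> R x y \<Longrightarrow> l \<le> y \<and> y \<le> r"
  shows "\<exists>Y. (\<forall>v. card {i. i < M \<and> v \<in> Y i} \<le> 2) \<and>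
    (\<forall>i<M. splits_off R {l<..<r} ({l<..<r} - Y i) (((i + c) mod M) * k) ((M - 1) * k))"
  using inside
proof (induction "r - l" arbitrary: l r c rule: less_induct)
  case less
  show ?case
  proof (cases "Suc l < r")
    case False
    then have "{l<..<r} = {}" by auto
    then show ?thesis
      by (intro exI[of _ "\<lambda>_. {}"]) (auto simp: splits_off_def intro: td_at_most.empty)
  next
    case lr: True
    have "\<exists>K s. separating_chain R K s \<and> s 0 = l \<and> s K = r \<and> 1 < K"
    proof (rule separating_chain_exists[of R l r])
      show "R y x" if "R x y" for x y using sym that .
      show "\<not> R b d" if "a < b" "b < c" "c < d" "R a c" for a b c d using noncrossing that .
      show "l \<le> y \<and> y \<le> r" if "l < x" "x < r" "R x y" for x y using less.prems that .
      show "Suc l < r" by (rule lr)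
    qed blast
    then obtain K s where "separating_chain R K s" and ends: "s 0 = l" "s K = r" and "1 < K"
      by blast
    then interpret separating_chain R K s by simp
    have "\<exists>Y. (\<forall>v. card {i. i < M \<and> v \<in> Y i} \<le> 2) \<and>
      (\<forall>i<M. splits_off R (gap u) (gap u - Y i) (((i + (c + (M - 1))) mod M) * k) ((M - 1) * k))"
      if u: "u < K" for u
    proof -
      have "s (Suc u) - s u < r - l"
      proof -
        have "l \<le> s u" "s u < s (Suc u)" "s (Suc u) \<le> r"
          using s_le[of 0 u] s_less[of u "Suc u"] s_le[of "Suc u" K] u ends by auto
        \<comment> \<open>The chain has an inner vertex, so no gap is the whole interval and the
          induction makes progress.\<close>
        moreover have "u \<noteq> 0 \<or> Suc u \<noteq> K" using \<open>1 < K\<close> by auto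
        then have "l < s u \<or> s (Suc u) < r"
          using s_less[of 0 u] s_less[of "Suc u" K] u ends by auto
        ultimately show ?thesis by linarith
      qed
      then show ?thesis
        unfolding gap_def by (rule less.hyps) (use gap_closed[OF u] in auto)
    qed
    then have "\<forall>u. \<exists>Y. u < K \<longrightarrow> (\<forall>v. card {i. i < M \<and> v \<in> Y i} \<le> 2) \<and>
      (\<forall>i<M. splits_off R (gap u) (gap u - Y i) (((i + (c + (M - 1))) mod M) * k) ((M - 1) * k))"
      by blast
    from choice[OF this] obtain Yg where
      "\<And>u v. u < K \<Longrightarrow> card {i. i < M \<and> v \<in> Yg u i} \<le> 2" and
      "\<And>u i. u < K \<Longrightarrow> i < M \<Longrightarrow>
        splits_off R (gap u) (gap u - Yg u i) (((i + (c + (M - 1))) mod M) * k) ((M - 1) * k)"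
      by blast
    then have "card {i. i < M \<and> v \<in> chain_deletion M c Yg i} \<le> 2"
      "i < M \<Longrightarrow> splits_off R {l<..<r} ({l<..<r} - chain_deletion M c Yg i) (((i + c) mod M) * k) ((M - 1) * k)" for v i
      using chain_deletion_card[of M Yg v c] chain_deletion_splits[of i M k Yg c] M ends by simp_all
    then show ?thesis by blast
  qed
qed

lemma splits_off_td_at_most:
  assumes "splits_off R I W d e" "\<And>x y. R x y \<Longrightarrow> R y x" "d \<le> e"
  shows "td_at_most R W e"
proof -
  obtain A B where "A \<union> B = W" "A \<inter> B = {}" "\<forall>x\<in>A. \<forall>y\<in>B. \<not> R x y"
    and "td_at_most R A d" "td_at_most R B e"
    using assms(1) unfolding splits_off_def by blast
  then show ?thesis
    using assms(2) td_at_most_mono[OF _ subset_refl assms(3)] td_at_most.union[of R A e B] by blast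
qed

section \<open>From a noncrossing order to fractional fragility\<close>

lemma simple_graph_delete_verts: "simple_graph G \<Longrightarrow> simple_graph (delete_verts G Y)"
  unfolding simple_graph_def delete_verts_def by auto

text \<open>A one-page book embedding of the graph induced on \<open>V\<close>: with the vertices on
  a line, all edges can be drawn as arcs on one side of it without crossings.\<close>

definition noncrossing_order :: "'a set set \<Rightarrow> 'a set \<Rightarrow> ('a \<Rightarrow> nat) \<Rightarrow> bool" where
  "noncrossing_order E V pos \<longleftrightarrow> inj_on pos V \<and>
     (\<forall>a\<in>V. \<forall>b\<in>V. \<forall>c\<in>V. \<forall>d\<in>V. pos a < pos b \<longrightarrow> pos b < pos c \<longrightarrow> pos c < pos d \<longrightarrow>
        {a, c} \<in> E \<longrightarrow> {b, d} \<notin> E)"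

lemma noncrossing_order_deletion:
  assumes G: "simple_graph G" and pos: "noncrossing_order (edges G) (verts G) pos"
    and M: "0 < M" "M \<le> 2 ^ k"
  obtains Z where "\<And>i. Z i \<subseteq> verts G" "\<And>v. card {i. i < M \<and> v \<in> Z i} \<le> 2"
    "\<And>i. i < M \<Longrightarrow> treedepth (delete_verts G (Z i)) \<le> (M - 1) * k"
proof -
  let ?V = "verts G" and ?E = "edges G"
  \<comment> \<open>Positions are shifted by one so that all vertices lie strictly between 0 and
    \<open>r\<close>, two artificial end points at which no vertex sits.\<close>
  let ?f = "\<lambda>v. Suc (pos v)"
  have inj: "inj_on pos ?V" and nc: "\<And>a b c d. a \<in> ?V \<Longrightarrow> b \<in> ?V \<Longrightarrow> c \<in> ?V \<Longrightarrow> d \<in> ?V \<Longrightarrow>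
      pos a < pos b \<Longrightarrow> pos b < pos c \<Longrightarrow> pos c < pos d \<Longrightarrow> {a, c} \<in> ?E \<Longrightarrow> {b, d} \<notin> ?E"
    using pos unfolding noncrossing_order_def by blast+
  have finV: "finite ?V" using G by (simp add: simple_graph_def)
  define r where "r = Suc (Suc (Max (insert 0 (pos ` ?V))))"
  have r: "?f v < r" if "v \<in> ?V" for v
    unfolding r_def using finV that by (auto simp: less_Suc_eq_le)
  define R where "R m n \<longleftrightarrow> (\<exists>x\<in>?V. \<exists>y\<in>?V. m = ?f x \<and> n = ?f y \<and> {x, y} \<in> ?E)" for m n
  have R_sym: "R n m" if "R m n" for m n
    using that unfolding R_def by (metis insert_commute)
  have R_nc: "\<not> R b d" if "a < b" "b < c" "c < d" "R a c" for a b c d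
  proof
    assume "R b d"
    with \<open>R a c\<close> obtain x y z w where "x \<in> ?V" "y \<in> ?V" "z \<in> ?V" "w \<in> ?V"
      "a = ?f x" "c = ?f y" "{x, y} \<in> ?E" "b = ?f z" "d = ?f w" "{z, w} \<in> ?E"
      unfolding R_def by blast
    then show False using nc[of x z y w] that(1-3) by simp
  qed
  have R_in: "0 \<le> y \<and> y \<le> r" if "R x y" for x y
    using that r unfolding R_def by (auto simp: less_imp_le)
  obtain Y where Y: "\<And>v. card {i. i < M \<and> v \<in> Y i} \<le> 2"
    and split: "\<And>i. i < M \<Longrightarrow> splits_off R {0<..<r} ({0<..<r} - Y i) (((i + 0) mod M) * k) ((M - 1) * k)"
    using interval_deletion[of R M k 0 r 0] R_sym R_nc R_in M by blast
  define Z where "Z i = {v \<in> ?V. ?f v \<in> Y i}" for i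
  have "treedepth (delete_verts G (Z i)) \<le> (M - 1) * k" if i: "i < M" for i
  proof (rule treedepth_le)
    show "simple_graph (delete_verts G (Z i))" using G by (rule simple_graph_delete_verts)
    have "td_at_most R ({0<..<r} - Y i) ((M - 1) * k)"
    proof (rule splits_off_td_at_most[OF split[OF i]])
      show "R n m" if "R m n" for m n using R_sym that .
      show "(i + 0) mod M * k \<le> (M - 1) * k" by (intro mult_le_mono1) (use i in simp)
    qed
    then have "td_at_most R (?f ` (?V - Z i)) ((M - 1) * k)"
      by (rule td_at_most_mono) (use r in \<open>auto simp: Z_def\<close>)
    then have "td_at_most (\<lambda>x y. {x, y} \<in> edges (delete_verts G (Z i))) (?V - Z i) ((M - 1) * k)"
    proof (rule td_at_most_inj_image)
      show "inj_on ?f (?V - Z i)" using inj by (auto simp: inj_on_def)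
    qed (auto simp: R_def delete_verts_def)
    then show "td_at_most (\<lambda>x y. {x, y} \<in> edges (delete_verts G (Z i)))
        (verts (delete_verts G (Z i))) ((M - 1) * k)"
      by (simp add: delete_verts_def)
  qed
  moreover have "card {i. i < M \<and> v \<in> Z i} \<le> 2" for v
  proof -
    have "card {i. i < M \<and> v \<in> Z i} \<le> card {i. i < M \<and> ?f v \<in> Y i}"
      by (intro card_mono) (auto simp: Z_def)
    then show ?thesis using Y[of "?f v"] by simp
  qed
  moreover have "Z i \<subseteq> ?V" for i by (auto simp: Z_def)
  ultimately show thesis using that by blast
qed

lemma le_power_ceiling_log:
  fixes a :: nat
  assumes "0 < a"
  shows "2 * a \<le> 2 ^ (1 + nat \<lceil>log 2 (real a)\<rceil>)"
proof -
  have "0 \<le> log 2 (real a)" using assms by simp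
  then have "log 2 (real a) \<le> real (nat \<lceil>log 2 (real a)\<rceil>)" by linarith
  then have "2 powr log 2 (real a) \<le> 2 powr real (nat \<lceil>log 2 (real a)\<rceil>)"
    by (intro powr_mono) auto
  then have "real a \<le> 2 powr real (nat \<lceil>log 2 (real a)\<rceil>)" using assms by simp
  then have "real a \<le> real (2 ^ nat \<lceil>log 2 (real a)\<rceil>)"
    by (simp add: powr_realpow)
  then show ?thesis by (simp only: of_nat_le_iff) simp
qed

lemma mono_rate: "mono (\<lambda>a::nat. 2 * real a * (1 + of_int \<lceil>log 2 (real a)\<rceil>))"
proof (rule monoI)
  fix a b :: nat
  assume ab: "a \<le> b"
  show "2 * real a * (1 + of_int \<lceil>log 2 (real a)\<rceil>) \<le> 2 * real b * (1 + of_int \<lceil>log 2 (real b)\<rceil>)"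
  proof (cases "a = 0")
    case True
    \<comment> \<open>In HOL \<open>ln 0 = 0\<close>, so the logarithm is nonnegative for
      \<open>b = 0\<close> as well.\<close>
    have "0 \<le> log 2 (real b)" by (cases "b = 0") (simp_all add: log_def)
    then have "0 \<le> \<lceil>log 2 (real b)\<rceil>" by linarith
    then show ?thesis using True by simp
  next
    case False
    then have "0 \<le> log 2 (real a)" by simp
    then have "0 \<le> \<lceil>log 2 (real a)\<rceil>" by linarith
    moreover have "\<lceil>log 2 (real a)\<rceil> \<le> \<lceil>log 2 (real b)\<rceil>"
      using False ab by (intro ceiling_mono) simp
    ultimately show ?thesis using ab by (intro mult_mono) auto
  qed
qed

text \<open>Take \<open>M = 2 * a\<close> and \<open>i\<close> uniform below \<open>M\<close>. A
  vertex is deleted for at most 2 of the \<open>2 * a\<close> values, that is, with probability at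
  most \<open>1 / a\<close>, and the treedepth bound \<open>(2 * a - 1) * k\<close> is at most the
  rate.\<close>

lemma fractionally_fragile_of_noncrossing_order:
  assumes G: "simple_graph G" and pos: "noncrossing_order (edges G) (verts G) pos"
  shows "fractionally_fragile (\<lambda>G. real (treedepth G))
     (\<lambda>a. 2 * real a * (1 + of_int \<lceil>log 2 (real a)\<rceil>)) G"
  unfolding fractionally_fragile_def
proof (intro conjI allI impI)
  let ?r = "\<lambda>a::nat. 2 * real a * (1 + of_int \<lceil>log 2 (real a)\<rceil>)"
  show "mono ?r" by (rule mono_rate)
  show "0 \<le> ?r a" for a
    \<comment> \<open>The rate has value 0 at 0, so monotonicity yields nonnegativity.\<close>
    using monoD[OF mono_rate, of 0 a] by simp
  fix a :: nat
  assume a: "0 < a"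
  \<comment> \<open>This is the rounded-up binary logarithm of \<open>2 * a\<close>, so that
    \<open>2 * a \<le> 2 ^ k\<close>.\<close>
  define k where "k = 1 + nat \<lceil>log 2 (real a)\<rceil>"
  obtain Z where Z: "\<And>i. Z i \<subseteq> verts G" and card_Z: "\<And>v. card {i. i < 2 * a \<and> v \<in> Z i} \<le> 2"
    and td_Z: "\<And>i. i < 2 * a \<Longrightarrow> treedepth (delete_verts G (Z i)) \<le> (2 * a - 1) * k"
    using noncrossing_order_deletion[OF G pos, of "2 * a" k] a le_power_ceiling_log[OF a]
    unfolding k_def by auto
  have "0 \<le> log 2 (real a)" using a by simp
  then have k: "real k = 1 + of_int \<lceil>log 2 (real a)\<rceil>" unfolding k_def by simp
  define D where "D = map_pmf Z (pmf_of_set {..<2 * a})"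
  have ne: "{..<2 * a} \<noteq> {}" using a by (simp add: lessThan_empty_iff)
  have set_D: "set_pmf D = Z ` {..<2 * a}" unfolding D_def using ne by simp
  have td: "real (treedepth (delete_verts G (Z i))) \<le> ?r a" if "i < 2 * a" for i
  proof -
    have "treedepth (delete_verts G (Z i)) \<le> 2 * a * k"
      using td_Z[OF that] by (rule order_trans) simp
    then have "real (treedepth (delete_verts G (Z i))) \<le> real (2 * a * k)" by (simp only: of_nat_le_iff)
    then show ?thesis using k by simp
  qed
  have prob: "measure_pmf.prob D {Y. v \<in> Y} \<le> 1 / real a" for v
  proof -
    have "measure_pmf.prob D {Y. v \<in> Y} = measure_pmf.prob (pmf_of_set {..<2 * a}) (Z -` {Y. v \<in> Y})"
      unfolding D_def by simp
    also have "\<dots> = real (card ({..<2 * a} \<inter> Z -` {Y. v \<in> Y})) / real (card {..<2 * a})"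
      using ne by (intro measure_pmf_of_set) auto
    also have "{..<2 * a} \<inter> Z -` {Y. v \<in> Y} = {i. i < 2 * a \<and> v \<in> Z i}" by auto
    also have "real (card \<dots>) / real (card {..<2 * a}) \<le> 2 / real (2 * a)"
      using card_Z[of v] by (intro divide_mono) (use a in auto)
    finally show ?thesis by simp
  qed
  show "\<exists>D. thin (1 / real a) G D \<and>
      set_pmf D \<subseteq> {Y. Y \<subseteq> verts G \<and> real (treedepth (delete_verts G Y)) \<le> ?r a}"
  proof (intro exI conjI)
    show "thin (1 / real a) G D"
      unfolding thin_def set_D by (intro conjI ballI prob image_subsetI PowI Z)
    show "set_pmf D \<subseteq> {Y. Y \<subseteq> verts G \<and> real (treedepth (delete_verts G Y)) \<le> ?r a}"
      unfolding set_D by (intro image_subsetI CollectI conjI Z td) simp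
  qed
qed

section \<open>Theta curves in outerplanar drawings\<close>

lemma closed_curve_regions:
  fixes g h :: "real \<Rightarrow> complex"
  assumes g: "arc g" "pathstart g = a" "pathfinish g = b"
    and h: "arc h" "pathstart h = a" "pathfinish h = b"
    and gh: "path_image g \<inter> path_image h = {a, b}"
  shows "connected (outside (path_image g \<union> path_image h))"
    "connected (inside (path_image g \<union> path_image h))"
    "inside (path_image g \<union> path_image h) \<noteq> {}"
    "bounded (inside (path_image g \<union> path_image h))"
    "frontier (inside (path_image g \<union> path_image h)) = path_image g \<union> path_image h"
proof -
  have "simple_path (g +++ reversepath h)"
    using assms by (subst simple_path_join_loop_eq) (auto simp: arc_reversepath)
  from Jordan_inside_outside[OF this] show "connected (outside (path_image g \<union> path_image h))"
    "connected (inside (path_image g \<union> path_image h))"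
    "inside (path_image g \<union> path_image h) \<noteq> {}"
    "bounded (inside (path_image g \<union> path_image h))"
    "frontier (inside (path_image g \<union> path_image h)) = path_image g \<union> path_image h"
    using assms by (auto simp: path_image_join)
qed

text \<open>An arc without its end points is connected and here avoids \<open>S\<close>, so it stays
  in one component of the complement.\<close>

lemma arc_endless_inside_or_outside:
  fixes c :: "real \<Rightarrow> complex"
  assumes "arc c" "pathstart c = a" "pathfinish c = b" "path_image c \<inter> S = {a, b}"
  shows "path_image c - {a, b} \<subseteq> inside S \<or> path_image c - {a, b} \<subseteq> outside S"
proof (rule ccontr)
  have conn: "connected (path_image c - {a, b})"
    using connected_simple_path_endless[of c] assms arc_imp_simple_path by blast
  assume "\<not> ?thesis"
  then obtain x y where xy: "x \<in> path_image c - {a, b}" "x \<notin> inside S" "y \<in> path_image c - {a, b}" "y \<notin> outside S"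
    by blast
  moreover have disj: "path_image c - {a, b} \<subseteq> - S" using assms by blast
  ultimately have "x \<in> outside S" "y \<in> inside S"
    using inside_Un_outside[of S] by blast+
  moreover have "connected_component (- S) x y"
    unfolding connected_component_def using conn xy disj by blast
  ultimately show False
    by (metis inside_same_component inside_Int_outside disjoint_iff connected_component_sym)
qed

text \<open>If no arc runs inside the curve formed by the other two, then a point inside the curve formed
  by \<open>g\<^sub>2\<close> and \<open>g\<^sub>3\<close> is separated from infinity neither by \<open>g\<^sub>1 \<union> g\<^sub>2\<close> nor by \<open>g\<^sub>1 \<union> g\<^sub>3\<close>, so Janiszewski's
  theorem contradicts that it is separated from infinity by the union of all three.\<close>

lemma theta_curve_arc_inside:
  fixes g1 g2 g3 :: "real \<Rightarrow> complex"
  assumes g1: "arc g1" "pathstart g1 = a" "pathfinish g1 = b"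
    and g2: "arc g2" "pathstart g2 = a" "pathfinish g2 = b"
    and g3: "arc g3" "pathstart g3 = a" "pathfinish g3 = b"
    and i12: "path_image g1 \<inter> path_image g2 = {a, b}"
    and i13: "path_image g1 \<inter> path_image g3 = {a, b}"
    and i23: "path_image g2 \<inter> path_image g3 = {a, b}"
  shows "path_image g1 - {a, b} \<subseteq> inside (path_image g2 \<union> path_image g3) \<or>
    path_image g2 - {a, b} \<subseteq> inside (path_image g1 \<union> path_image g3) \<or>
    path_image g3 - {a, b} \<subseteq> inside (path_image g1 \<union> path_image g2)"
proof (rule ccontr)
  let ?P1 = "path_image g1" and ?P2 = "path_image g2" and ?P3 = "path_image g3"
  assume not: "\<not> ?thesis"
  have out1: "?P1 - {a, b} \<subseteq> outside (?P2 \<union> ?P3)"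
    using arc_endless_inside_or_outside[OF g1, of "?P2 \<union> ?P3"] not i12 i13 by blast
  have out2: "?P2 - {a, b} \<subseteq> outside (?P1 \<union> ?P3)"
    using arc_endless_inside_or_outside[OF g2, of "?P1 \<union> ?P3"] not i12 i23 by blast
  have out3: "?P3 - {a, b} \<subseteq> outside (?P1 \<union> ?P2)"
    using arc_endless_inside_or_outside[OF g3, of "?P1 \<union> ?P2"] not i13 i23 by blast
  have i21: "?P2 \<inter> ?P1 = {a, b}" and i31: "?P3 \<inter> ?P1 = {a, b}" using i12 i13 by auto
  note r23 = closed_curve_regions[OF g2 g3 i23]
  note r12 = closed_curve_regions[OF g1 g2 i12]
  note r13 = closed_curve_regions[OF g1 g3 i13]
  have "a \<noteq> b" using g1 arc_distinct_ends by blast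
  let ?I = "inside (?P2 \<union> ?P3)"
  obtain z where z: "z \<in> ?I" using r23(3) by blast
  have bdd: "bounded (?P1 \<union> ?P2 \<union> ?P3)"
    using g1 g2 g3 by (simp add: bounded_arc_image)
  \<comment> \<open>Here \<open>g\<close> and \<open>h\<close> stand for \<open>g2\<close> and
    \<open>g3\<close> in either order. If \<open>?I\<close> met the inside of the curve of
    \<open>g1\<close> and \<open>g\<close>, it would lie in it by connectedness. Then
    \<open>h\<close>, being part of the frontier of \<open>?I\<close>, would lie in the closure of
    that inside, although it runs outside.\<close>
  have I_out: "?I \<subseteq> outside (?P1 \<union> path_image g)"
    if gi: "path_image g \<subseteq> ?P2 \<union> ?P3" and h: "?P2 \<union> ?P3 = path_image g \<union> path_image h"
      and ho: "path_image h - {a, b} \<subseteq> outside (?P1 \<union> path_image g)"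
      and garc: "arc g" and harc: "arc h" "pathstart h = a" "pathfinish h = b" for g h
  proof (rule ccontr)
    assume n: "\<not> ?I \<subseteq> outside (?P1 \<union> path_image g)"
    have "?I \<inter> ?P1 = {}"
      using out1 inside_no_overlap[of "?P2 \<union> ?P3"] inside_Int_outside[of "?P2 \<union> ?P3"] i12 by blast
    then have disj: "?I \<subseteq> - (?P1 \<union> path_image g)"
      using gi inside_no_overlap[of "?P2 \<union> ?P3"] by blast
    obtain x where x: "x \<in> ?I" "x \<in> inside (?P1 \<union> path_image g)"
      using n disj inside_Un_outside[of "?P1 \<union> path_image g"] by blast
    have "?I \<subseteq> inside (?P1 \<union> path_image g)"
    proof
      fix y assume "y \<in> ?I"
      then have "connected_component (- (?P1 \<union> path_image g)) x y"
        unfolding connected_component_def using r23(2) disj x by blast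
      then show "y \<in> inside (?P1 \<union> path_image g)" using x inside_same_component by metis
    qed
    then have cl: "closure ?I \<subseteq> closure (inside (?P1 \<union> path_image g))" by (rule closure_mono)
    have "path_image h \<subseteq> closure ?I"
      using r23(5) h unfolding frontier_def by blast
    moreover have "closure (inside (?P1 \<union> path_image g)) \<subseteq> (?P1 \<union> path_image g) \<union> inside (?P1 \<union> path_image g)"
      using g1(1) garc by (intro closure_inside_subset closed_Un closed_arc_image)
    moreover have "path_image h - {a, b} \<noteq> {}"
      using nonempty_simple_path_endless[OF arc_imp_simple_path[OF harc(1)]] harc by simp
    ultimately show False
      using ho cl outside_no_overlap[of "?P1 \<union> path_image g"] inside_Int_outside[of "?P1 \<union> path_image g"] by blast
  qed
  have I12: "?I \<subseteq> outside (?P1 \<union> ?P2)"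
    by (rule I_out[of g2 g3]) (use out3 g2 g3 in auto)
  have I13: "?I \<subseteq> outside (?P1 \<union> ?P3)"
    by (rule I_out[of g3 g2]) (use out2 g2 g3 in auto)
  have "\<not> bounded (outside (?P1 \<union> ?P2 \<union> ?P3))"
    using unbounded_outside[OF bdd] .
  \<comment> \<open>The point \<open>w\<close> represents infinity: it lies outside all three
    curves.\<close>
  then obtain w where w: "w \<in> outside (?P1 \<union> ?P2 \<union> ?P3)" by fastforce
  have w12: "w \<in> outside (?P1 \<union> ?P2)" and w13: "w \<in> outside (?P1 \<union> ?P3)" and w23: "w \<in> outside (?P2 \<union> ?P3)"
    using w outside_mono[of "?P1 \<union> ?P2" "?P1 \<union> ?P2 \<union> ?P3"] outside_mono[of "?P1 \<union> ?P3" "?P1 \<union> ?P2 \<union> ?P3"]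
      outside_mono[of "?P2 \<union> ?P3" "?P1 \<union> ?P2 \<union> ?P3"] by blast+
  have "connected_component (- ((?P1 \<union> ?P2) \<union> (?P1 \<union> ?P3))) z w"
  proof (rule Janiszewski)
    show "compact (?P1 \<union> ?P2)" "closed (?P1 \<union> ?P3)"
      using g1 g2 g3 by (simp_all add: compact_Un compact_arc_image closed_Un closed_arc_image)
    have "(?P1 \<union> ?P2) \<inter> (?P1 \<union> ?P3) = ?P1" using i12 i13 i23 by blast
    then show "connected ((?P1 \<union> ?P2) \<inter> (?P1 \<union> ?P3))"
      using g1 by (simp add: connected_arc_image)
    show "connected_component (- (?P1 \<union> ?P2)) z w"
      unfolding connected_component_def
      using r12(1) outside_no_overlap[of "?P1 \<union> ?P2"] I12 z w12 by blast
    show "connected_component (- (?P1 \<union> ?P3)) z w"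
      unfolding connected_component_def
      using r13(1) outside_no_overlap[of "?P1 \<union> ?P3"] I13 z w13 by blast
  qed
  then have "connected_component (- (?P2 \<union> ?P3)) z w"
    by (rule connected_component_of_subset) blast
  then have "w \<in> ?I" using z inside_same_component by metis
  then show False using w23 inside_Int_outside[of "?P2 \<union> ?P3"] by blast
qed

text \<open>Serves to conclude that the ends of a chord belong to the closure of any region
  containing the rest of the chord.\<close>

lemma closure_arc_endless:
  fixes c :: "real \<Rightarrow> complex"
  assumes "arc c"
  shows "closure (path_image c - {pathstart c, pathfinish c}) = path_image c"
proof
  show "closure (path_image c - {pathstart c, pathfinish c}) \<subseteq> path_image c"
    using closed_arc_image[OF assms] by (intro closure_minimal) auto
  have "continuous_on (closure {0<..<1}) c"
    using assms by (simp add: arc_def path_def)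
  then have "c ` closure {0<..<1} \<subseteq> closure (c ` {0<..<1})"
    by (rule continuous_image_closure_subset) simp
  then show "path_image c \<subseteq> closure (path_image c - {pathstart c, pathfinish c})"
    using simple_path_endless[OF arc_imp_simple_path[OF assms]] by (simp add: path_image_def)
qed

section \<open>Paths as vertex lists and the two excluded configurations\<close>

fun path_edges :: "'a list \<Rightarrow> 'a set set" where
  "path_edges (x # y # zs) = insert {x, y} (path_edges (y # zs))"
| "path_edges _ = {}"

lemma path_edges_subset: "e \<in> path_edges xs \<Longrightarrow> e \<subseteq> set xs"
  by (induction xs rule: path_edges.induct) auto

lemma path_edges_append: "path_edges (xs @ y # ys) = path_edges (xs @ [y]) \<union> path_edges (y # ys)"
  by (induction xs rule: path_edges.induct) auto

lemma path_edges_rev: "path_edges (rev xs) = path_edges xs"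
proof (induction xs rule: path_edges.induct)
  case (1 x y zs)
  then show ?case
    using path_edges_append[of "rev zs" y "[x]"] by (simp add: insert_commute)
qed auto

lemma path_edges_cover: "2 \<le> length xs \<Longrightarrow> v \<in> set xs \<Longrightarrow> \<exists>e\<in>path_edges xs. v \<in> e"
proof (induction xs rule: path_edges.induct)
  case (1 x y zs)
  then show ?case by (cases zs) auto
qed auto

lemma ends_not_path_edge: "distinct (x # q @ [y]) \<Longrightarrow> q \<noteq> [] \<Longrightarrow> {x, y} \<notin> path_edges (x # q @ [y])"
  using path_edges_subset[of "{x, y}" "tl q @ [y]"] path_edges_subset[of "{x, y}" "q @ [y]"]
  by (cases q) (auto simp: doubleton_eq_iff)

definition graph_path :: "'a set set \<Rightarrow> 'a list \<Rightarrow> bool" where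
  "graph_path E xs \<longleftrightarrow> distinct xs \<and> path_edges xs \<subseteq> E"

lemma graph_path_rev: "graph_path E xs \<Longrightarrow> graph_path E (rev xs)"
  by (simp add: graph_path_def path_edges_rev)

text \<open>Excludes subdivisions of the complete bipartite graph K_{2,3}; distinctness in
  \<open>graph_path\<close> forces \<open>x\<close> and \<open>y\<close> to differ.\<close>

definition no_theta :: "'a set set \<Rightarrow> bool" where
  "no_theta E \<longleftrightarrow> (\<nexists>x y q1 q2 q3. graph_path E (x # q1 @ [y]) \<and> graph_path E (x # q2 @ [y]) \<and>
     graph_path E (x # q3 @ [y]) \<and> q1 \<noteq> [] \<and> q2 \<noteq> [] \<and> q3 \<noteq> [] \<and>
     set q1 \<inter> set q2 = {} \<and> set q1 \<inter> set q3 = {} \<and> set q2 \<inter> set q3 = {})"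

text \<open>The two paths form a cycle on which \<open>x\<close>, \<open>u\<close>,
  \<open>y\<close>, \<open>w\<close> alternate. With the chords this is a subdivision of K_4 in
  which two opposite edges remain single edges.\<close>

definition no_crossing_chords :: "'a set set \<Rightarrow> bool" where
  "no_crossing_chords E \<longleftrightarrow> (\<nexists>x y q1 q2 u w. graph_path E (x # q1 @ [y]) \<and> graph_path E (x # q2 @ [y]) \<and>
     set q1 \<inter> set q2 = {} \<and> u \<in> set q1 \<and> w \<in> set q2 \<and> {x, y} \<in> E \<and> {u, w} \<in> E)"

section \<open>Paths of an outerplanar drawing as arcs in the plane\<close>

locale outerplane_drawing =
  fixes G :: "'a ugraph" and p :: "'a \<Rightarrow> complex" and \<gamma> :: "'a set \<Rightarrow> real \<Rightarrow> complex"
  assumes simple: "simple_graph G" and drawing: "plane_drawing G p \<gamma>"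
    and outer: "v \<in> verts G \<Longrightarrow> p v \<in> frontier (outside (drawing_image G p \<gamma>))"
begin

abbreviation "E \<equiv> edges G"

definition trace :: "'a list \<Rightarrow> complex set" where
  "trace xs = (\<Union>e\<in>path_edges xs. path_image (\<gamma> e))"

lemma edge_arc: "e \<in> E \<Longrightarrow> arc (\<gamma> e)"
  and edge_ends: "e \<in> E \<Longrightarrow> {pathstart (\<gamma> e), pathfinish (\<gamma> e)} = p ` e"
  and edge_Int: "e \<in> E \<Longrightarrow> e' \<in> E \<Longrightarrow> e \<noteq> e' \<Longrightarrow> path_image (\<gamma> e) \<inter> path_image (\<gamma> e') = p ` (e \<inter> e')"
  and inj_p: "inj_on p (verts G)"
  using drawing unfolding plane_drawing_def by blast+

lemma edge_verts: "e \<in> E \<Longrightarrow> e \<subseteq> verts G" and edge_card: "e \<in> E \<Longrightarrow> card e = 2"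
  using simple unfolding simple_graph_def by blast+

lemma ends_in_edge: "e \<in> E \<Longrightarrow> v \<in> e \<Longrightarrow> p v \<in> path_image (\<gamma> e)"
  using edge_ends[of e] by (metis imageI insert_iff empty_iff pathstart_in_path_image pathfinish_in_path_image)

lemma graph_path_verts:
  assumes "graph_path E xs" "2 \<le> length xs"
  shows "set xs \<subseteq> verts G"
  using path_edges_cover[OF assms(2)] assms(1) edge_verts unfolding graph_path_def by blast

lemma trace_vertex: "graph_path E xs \<Longrightarrow> 2 \<le> length xs \<Longrightarrow> v \<in> set xs \<Longrightarrow> p v \<in> trace xs"
  using path_edges_cover[of xs v] ends_in_edge unfolding graph_path_def trace_def by blast

lemma trace_Int_subset:
  assumes "path_edges xs \<subseteq> E" "path_edges ys \<subseteq> E" "path_edges xs \<inter> path_edges ys = {}"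
  shows "trace xs \<inter> trace ys \<subseteq> p ` (set xs \<inter> set ys)"
proof
  fix z assume "z \<in> trace xs \<inter> trace ys"
  then obtain e e' where e: "e \<in> path_edges xs" "e' \<in> path_edges ys"
    and z: "z \<in> path_image (\<gamma> e) \<inter> path_image (\<gamma> e')"
    unfolding trace_def by blast
  then have "e \<noteq> e'" using assms(3) by blast
  then have "z \<in> p ` (e \<inter> e')" using edge_Int e z assms by blast
  then show "z \<in> p ` (set xs \<inter> set ys)" using path_edges_subset e by fast
qed

lemma graph_path_arc:
  assumes "graph_path E xs" "2 \<le> length xs"
  shows "\<exists>g. arc g \<and> pathstart g = p (hd xs) \<and> pathfinish g = p (last xs) \<and> path_image g = trace xs"
  using assms
proof (induction xs rule: path_edges.induct)
  case (1 x y zs)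
  have e: "{x, y} \<in> E" using 1 by (simp add: graph_path_def)
  \<comment> \<open>A drawing does not fix the direction of the arc of an edge, so it may have to be
    reversed to start at \<open>p x\<close>.\<close>
  have "\<exists>h. arc h \<and> pathstart h = p x \<and> pathfinish h = p y \<and> path_image h = path_image (\<gamma> {x, y})"
  proof (cases "pathstart (\<gamma> {x, y}) = p x")
    case True
    moreover from this have "pathfinish (\<gamma> {x, y}) = p y"
      using edge_ends[OF e] arc_distinct_ends[OF edge_arc[OF e]] by (auto simp: doubleton_eq_iff)
    ultimately show ?thesis using edge_arc[OF e] by blast
  next
    case False
    then have "pathstart (\<gamma> {x, y}) = p y" "pathfinish (\<gamma> {x, y}) = p x"
      using edge_ends[OF e] by (auto simp: doubleton_eq_iff)
    then show ?thesis using edge_arc[OF e]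
      by (intro exI[of _ "reversepath (\<gamma> {x, y})"]) (simp add: arc_reversepath)
  qed
  then obtain h where h: "arc h" "pathstart h = p x" "pathfinish h = p y" "path_image h = path_image (\<gamma> {x, y})"
    by blast
  show ?case
  proof (cases zs)
    case Nil
    then show ?thesis using h by (auto simp: trace_def)
  next
    case (Cons z zs')
    have tl: "graph_path E (y # zs)" using 1 by (simp add: graph_path_def)
    then obtain g where g: "arc g" "pathstart g = p y" "pathfinish g = p (last (y # zs))" "path_image g = trace (y # zs)"
      using 1 Cons by auto
    have "path_edges [x, y] \<inter> path_edges (y # zs) = {}"
      using path_edges_subset[of "{x, y}" "y # zs"] 1 by (auto simp: graph_path_def)
    then have "trace [x, y] \<inter> trace (y # zs) \<subseteq> p ` (set [x, y] \<inter> set (y # zs))"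
      using e tl by (intro trace_Int_subset) (auto simp: graph_path_def)
    also have "set [x, y] \<inter> set (y # zs) = {y}" using 1 by (auto simp: graph_path_def)
    finally have "path_image h \<inter> path_image g \<subseteq> {pathstart g}"
      using h g by (simp add: trace_def)
    then have "arc (h +++ g)" using h g by (intro arc_join) auto
    moreover have "path_image (h +++ g) = trace (x # y # zs)"
      using h g by (simp add: path_image_join trace_def)
    ultimately show ?thesis using h g by (intro exI[of _ "h +++ g"]) auto
  qed
qed auto

lemma trace_subset: "path_edges xs \<subseteq> E \<Longrightarrow> trace xs \<subseteq> drawing_image G p \<gamma>"
  unfolding trace_def drawing_image_def by blast

text \<open>The only use of \<open>outer\<close>: \<open>p v\<close> is a limit of points outside
  the whole drawing, and these lie outside \<open>S\<close> too, whereas the inside of a closed set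
  is open and would contain some of them.\<close>

lemma vertex_not_inside:
  assumes "v \<in> verts G" "S \<subseteq> drawing_image G p \<gamma>" "closed S"
  shows "p v \<notin> inside S"
proof
  assume "p v \<in> inside S"
  moreover have "open (inside S)" using assms(3) by (rule open_inside)
  moreover have "p v \<in> closure (outside (drawing_image G p \<gamma>))"
    using outer[OF assms(1)] by (simp add: frontier_def)
  ultimately obtain z where "z \<in> inside S" "z \<in> outside (drawing_image G p \<gamma>)"
    by (metis disjoint_iff open_Int_closure_eq_empty)
  then show False using outside_mono[OF assms(2)] inside_Int_outside[of S] by blast
qed

text \<open>A common edge would have both ends in \<open>{x, y}\<close>, so it would be the edge
  \<open>{x, y}\<close>, which does not occur on a path from \<open>x\<close> to \<open>y\<close>
  with inner vertices. Hence the paths are edge-disjoint and meet only in common vertices.\<close>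

lemma parallel_paths_Int:
  assumes xs: "graph_path E (x # q1 @ [y])" and ys: "graph_path E (x # q2 @ [y])"
    and dis: "set q1 \<inter> set q2 = {}" "q1 \<noteq> [] \<or> q2 \<noteq> []"
  shows "trace (x # q1 @ [y]) \<inter> trace (x # q2 @ [y]) = {p x, p y}"
proof
  have "path_edges (x # q1 @ [y]) \<inter> path_edges (x # q2 @ [y]) = {}"
  proof (rule ccontr)
    assume "path_edges (x # q1 @ [y]) \<inter> path_edges (x # q2 @ [y]) \<noteq> {}"
    then obtain e where e: "e \<in> path_edges (x # q1 @ [y])" "e \<in> path_edges (x # q2 @ [y])" by blast
    then have "e \<subseteq> {x, y}"
      using path_edges_subset[OF e(1)] path_edges_subset[OF e(2)] dis by auto
    moreover have "card e = 2" using edge_card e xs unfolding graph_path_def by blast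
    moreover have "card {x, y} = 2" using xs by (simp add: graph_path_def)
    ultimately have "e = {x, y}" by (metis card_subset_eq finite.emptyI finite_insert)
    then show False using e dis(2) ends_not_path_edge xs ys unfolding graph_path_def by metis
  qed
  then show "trace (x # q1 @ [y]) \<inter> trace (x # q2 @ [y]) \<subseteq> {p x, p y}"
    using trace_Int_subset[of "x # q1 @ [y]" "x # q2 @ [y]"] xs ys dis unfolding graph_path_def by auto
  show "{p x, p y} \<subseteq> trace (x # q1 @ [y]) \<inter> trace (x # q2 @ [y])"
    using trace_vertex[OF xs] trace_vertex[OF ys] by auto
qed

lemma closed_trace: "graph_path E xs \<Longrightarrow> 2 \<le> length xs \<Longrightarrow> closed (trace xs)"
  using graph_path_arc[of xs] closed_arc_image by metis

lemma inner_vertex_not_inside: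
  assumes "graph_path E (x # q @ [y])" "graph_path E xs" "graph_path E ys"
    and "2 \<le> length xs" "2 \<le> length ys" "q \<noteq> []"
  shows "\<not> trace (x # q @ [y]) - {p x, p y} \<subseteq> inside (trace xs \<union> trace ys)"
proof -
  obtain v where v: "v \<in> set q" using assms(6) by (meson list.set_sel(1))
  have sub: "set (x # q @ [y]) \<subseteq> verts G" using graph_path_verts[OF assms(1)] by simp
  have "p v \<noteq> p x" "p v \<noteq> p y"
    using inj_p sub v assms(1) unfolding graph_path_def inj_on_def by auto
  moreover have "p v \<in> trace (x # q @ [y])" using trace_vertex[OF assms(1)] v by simp
  moreover have "p v \<notin> inside (trace xs \<union> trace ys)"
  proof (rule vertex_not_inside)
    show "trace xs \<union> trace ys \<subseteq> drawing_image G p \<gamma>"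
      using trace_subset assms(2,3) unfolding graph_path_def by blast
    show "closed (trace xs \<union> trace ys)"
      using closed_trace assms by blast
  qed (use v sub in auto)
  ultimately show ?thesis by blast
qed

text \<open>One of the three arcs runs inside the curve of the other two; it is neither of the first
  two, because these have inner vertices. The list \<open>q3\<close> may be empty, so the lemma also
  places a chord of a cycle inside that cycle.\<close>

lemma parallel_paths_theta:
  assumes P: "graph_path E (x # q1 @ [y])" "graph_path E (x # q2 @ [y])" "graph_path E (x # q3 @ [y])"
    and ne: "q1 \<noteq> []" "q2 \<noteq> []"
    and dis: "set q1 \<inter> set q2 = {}" "set q1 \<inter> set q3 = {}" "set q2 \<inter> set q3 = {}"
  shows "trace (x # q3 @ [y]) - {p x, p y} \<subseteq> inside (trace (x # q1 @ [y]) \<union> trace (x # q2 @ [y]))"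
proof -
  obtain g1 where g1: "arc g1" "pathstart g1 = p x" "pathfinish g1 = p y" "path_image g1 = trace (x # q1 @ [y])"
    using graph_path_arc[OF P(1)] by auto
  obtain g2 where g2: "arc g2" "pathstart g2 = p x" "pathfinish g2 = p y" "path_image g2 = trace (x # q2 @ [y])"
    using graph_path_arc[OF P(2)] by auto
  obtain g3 where g3: "arc g3" "pathstart g3 = p x" "pathfinish g3 = p y" "path_image g3 = trace (x # q3 @ [y])"
    using graph_path_arc[OF P(3)] by auto
  have "path_image g1 \<inter> path_image g2 = {p x, p y}" "path_image g1 \<inter> path_image g3 = {p x, p y}"
    "path_image g2 \<inter> path_image g3 = {p x, p y}"
    using g1(4) g2(4) g3(4) parallel_paths_Int P ne dis by metis+
  from theta_curve_arc_inside[OF g1(1-3) g2(1-3) g3(1-3) this] show ?thesis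
    using inner_vertex_not_inside[OF P(1,2,3)] inner_vertex_not_inside[OF P(2,1,3)] ne
    unfolding g1(4) g2(4) g3(4) by auto
qed

lemma no_theta_edges: "no_theta E"
  unfolding no_theta_def
proof (intro notI, elim exE conjE)
  fix x y q1 q2 q3
  assume P: "graph_path E (x # q1 @ [y])" "graph_path E (x # q2 @ [y])" "graph_path E (x # q3 @ [y])"
    and ne: "q1 \<noteq> []" "q2 \<noteq> []" "q3 \<noteq> []"
    and dis: "set q1 \<inter> set q2 = {}" "set q1 \<inter> set q3 = {}" "set q2 \<inter> set q3 = {}"
  show False
    using parallel_paths_theta[OF P ne(1,2) dis] inner_vertex_not_inside[OF P(3,1,2)] ne(3) by simp
qed

text \<open>Both chords run inside the cycle, and \<open>{x, y}\<close> divides its inside into two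
  regions. The chord \<open>{u, w}\<close> avoids \<open>{x, y}\<close>, so it stays in one region.
  One of its ends is off the boundary of that region and would therefore be inside a closed
  curve.\<close>

lemma no_crossing_chords_edges: "no_crossing_chords E"
  unfolding no_crossing_chords_def
proof (intro notI, elim exE conjE)
  fix x y q1 q2 u w
  assume P: "graph_path E (x # q1 @ [y])" "graph_path E (x # q2 @ [y])"
    and dis: "set q1 \<inter> set q2 = {}" and uw: "u \<in> set q1" "w \<in> set q2" and ch: "{x, y} \<in> E" "{u, w} \<in> E"
  obtain a1 b1 where q1: "q1 = a1 @ u # b1" using uw by (meson split_list)
  obtain a2 b2 where q2: "q2 = a2 @ w # b2" using uw by (meson split_list)
  have "x \<noteq> y" "u \<noteq> w" using P uw dis unfolding graph_path_def by auto
  then have C: "graph_path E (x # [] @ [y])" "graph_path E (u # [] @ [w])"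
    using ch by (auto simp: graph_path_def)
  \<comment> \<open>The same cycle, cut at \<open>u\<close> and \<open>w\<close> instead of
    \<open>x\<close> and \<open>y\<close>, so that \<open>{u, w}\<close> also becomes a third
    parallel path.\<close>
  let ?r1 = "b1 @ y # rev b2" and ?r2 = "rev a1 @ x # a2"
  have e1: "path_edges (x # q1 @ [y]) = path_edges (x # a1 @ [u]) \<union> path_edges (u # b1 @ [y])"
    using path_edges_append[of "x # a1" u "b1 @ [y]"] q1 by simp
  have e2: "path_edges (x # q2 @ [y]) = path_edges (x # a2 @ [w]) \<union> path_edges (w # b2 @ [y])"
    using path_edges_append[of "x # a2" w "b2 @ [y]"] q2 by simp
  have r1: "path_edges (u # ?r1 @ [w]) = path_edges (u # b1 @ [y]) \<union> path_edges (w # b2 @ [y])"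
    using path_edges_append[of "u # b1" y "rev b2 @ [w]"] path_edges_rev[of "w # b2 @ [y]"] by simp
  have r2: "path_edges (u # ?r2 @ [w]) = path_edges (x # a1 @ [u]) \<union> path_edges (x # a2 @ [w])"
    using path_edges_append[of "u # rev a1" x "a2 @ [w]"] path_edges_rev[of "x # a1 @ [u]"] by simp
  have R: "graph_path E (u # ?r1 @ [w])" "graph_path E (u # ?r2 @ [w])"
    using P dis r1 r2 e1 e2 unfolding graph_path_def q1 q2 by auto
  let ?X1 = "trace (x # q1 @ [y])" and ?X2 = "trace (x # q2 @ [y])" and ?X = "trace [x, y]" and ?U = "trace [u, w]"
  have same: "trace (u # ?r1 @ [w]) \<union> trace (u # ?r2 @ [w]) = ?X1 \<union> ?X2"
    unfolding trace_def e1 e2 r1 r2 by blast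
  have X_in: "?X - {p x, p y} \<subseteq> inside (?X1 \<union> ?X2)"
    using parallel_paths_theta[OF P C(1)] uw dis by (cases q1; cases q2) auto
  have "trace (u # [] @ [w]) - {p u, p w} \<subseteq> inside (trace (u # ?r1 @ [w]) \<union> trace (u # ?r2 @ [w]))"
    by (rule parallel_paths_theta[OF R C(2)]) (use dis P in \<open>auto simp: graph_path_def q1 q2\<close>)
  then have U_in: "?U - {p u, p w} \<subseteq> inside (?X1 \<union> ?X2)"
    unfolding same by simp
  obtain g1 where g1: "arc g1" "pathstart g1 = p x" "pathfinish g1 = p y" "path_image g1 = ?X1"
    using graph_path_arc[OF P(1)] by auto
  obtain g2 where g2: "arc g2" "pathstart g2 = p x" "pathfinish g2 = p y" "path_image g2 = ?X2"
    using graph_path_arc[OF P(2)] by auto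
  obtain g where g: "arc g" "pathstart g = p x" "pathfinish g = p y" "path_image g = ?X"
    using graph_path_arc[OF C(1)] by auto
  obtain h where h: "arc h" "pathstart h = p u" "pathfinish h = p w" "path_image h = ?U"
    using graph_path_arc[OF C(2)] by auto
  have ne: "q1 \<noteq> []" "q2 \<noteq> []" using uw by auto
  have Int12: "?X1 \<inter> ?X2 = {p x, p y}" using parallel_paths_Int[OF P dis] ne by auto
  have Int1: "?X1 \<inter> ?X = {p x, p y}" using parallel_paths_Int[OF P(1) C(1)] ne by auto
  have Int2: "?X2 \<inter> ?X = {p x, p y}" using parallel_paths_Int[OF P(2) C(1)] ne by auto
  have sub: "{x, y, u, w} \<subseteq> verts G" using ch edge_verts by blast
  have ne4: "x \<noteq> u" "x \<noteq> w" "y \<noteq> u" "y \<noteq> w" using P uw unfolding graph_path_def by auto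
  have IntXU: "?X \<inter> ?U = {}"
    using trace_Int_subset[of "[x, y]" "[u, w]"] ch ne4 by (auto simp: doubleton_eq_iff)
  have "p x \<noteq> p y" using arc_distinct_ends[OF g(1)] g by simp
  have nonempty: "?X - {p x, p y} \<noteq> {}" "?U - {p u, p w} \<noteq> {}"
    using nonempty_simple_path_endless[OF arc_imp_simple_path[OF g(1)]]
      nonempty_simple_path_endless[OF arc_imp_simple_path[OF h(1)]] g h by simp_all
  then have meets: "?X \<inter> inside (?X1 \<union> ?X2) \<noteq> {}" using X_in by blast
  obtain disj: "inside (?X1 \<union> ?X) \<inter> inside (?X2 \<union> ?X) = {}"
    and split: "inside (?X1 \<union> ?X) \<union> inside (?X2 \<union> ?X) \<union> (?X - {p x, p y}) = inside (?X1 \<union> ?X2)"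
    by (rule split_inside_simple_closed_curve[OF arc_imp_simple_path[OF g1(1)] g1(2,3)
          arc_imp_simple_path[OF g2(1)] g2(2,3) arc_imp_simple_path[OF g(1)] g(2,3) \<open>p x \<noteq> p y\<close>,
          unfolded g(4) g1(4) g2(4), OF Int12 Int1 Int2 meets])
  have conn: "connected (?U - {p u, p w})"
    using connected_simple_path_endless[OF arc_imp_simple_path[OF h(1)]] h by simp
  have opens: "open (inside (?X1 \<union> ?X))" "open (inside (?X2 \<union> ?X))"
    using closed_trace[OF P(1)] closed_trace[OF P(2)] closed_trace[OF C(1)]
    by (auto intro!: open_inside)
  have "?U - {p u, p w} \<subseteq> inside (?X1 \<union> ?X) \<union> inside (?X2 \<union> ?X)"
    using U_in IntXU split by blast
  then have "?U - {p u, p w} \<subseteq> inside (?X1 \<union> ?X) \<or> ?U - {p u, p w} \<subseteq> inside (?X2 \<union> ?X)"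
    using connectedD[OF conn opens] disj by blast
  \<comment> \<open>Used for \<open>q1\<close> with \<open>z = w\<close> and for \<open>q2\<close>
    with \<open>z = u\<close>: \<open>z\<close> is the end of the second chord on the opposite side
    of the first.\<close>
  moreover have False
    if in_q: "?U - {p u, p w} \<subseteq> inside (trace (x # q @ [y]) \<union> ?X)" and q: "graph_path E (x # q @ [y])"
      and z: "z \<in> {u, w}" "z \<notin> set q" and v: "p z \<notin> trace (x # q @ [y])" for q z
  proof -
    let ?S = "trace (x # q @ [y]) \<union> ?X"
    have S: "closed ?S" "?S \<subseteq> drawing_image G p \<gamma>"
      using closed_trace[OF q] closed_trace[OF C(1)] trace_subset q C(1) unfolding graph_path_def by auto
    have "p z \<in> ?U" using trace_vertex[OF C(2)] z by auto
    then have "p z \<in> closure (?U - {p u, p w})"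
      using closure_arc_endless[OF h(1)] h by simp
    also have "\<dots> \<subseteq> ?S \<union> inside ?S"
      using closure_mono[OF in_q] closure_inside_subset[OF S(1)] by blast
    finally have "p z \<in> ?S" using vertex_not_inside[of z ?S] S z sub by blast
    then show False using v IntXU \<open>p z \<in> ?U\<close> by blast
  qed
  moreover have "p u \<notin> ?X2" "p w \<notin> ?X1"
  proof -
    have "p z \<noteq> p x" "p z \<noteq> p y" if "z \<in> {u, w}" for z
      using inj_p sub ne4 that unfolding inj_on_def by blast+
    moreover have "p u \<in> ?X1" "p w \<in> ?X2"
      using trace_vertex[OF P(1)] trace_vertex[OF P(2)] uw by auto
    ultimately show "p u \<notin> ?X2" "p w \<notin> ?X1" using Int12 by blast+
  qed
  ultimately show False using P uw dis by blast
qed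

end

section \<open>Noncrossing orders\<close>

lemma noncrossing_orderD:
  assumes "noncrossing_order E V pos" "a \<in> V" "b \<in> V" "c \<in> V" "d \<in> V"
    "pos a < pos b" "pos b < pos c" "pos c < pos d" "{a, c} \<in> E"
  shows "{b, d} \<notin> E"
  using assms unfolding noncrossing_order_def by blast

text \<open>Whether two edges cross depends only on the cyclic order of their ends, so the line may
  be closed to a circle and cut open again just before \<open>x\<close>.\<close>

lemma noncrossing_order_rotate:
  assumes pos: "noncrossing_order E V pos" and V: "finite V" and x: "x \<in> V"
  obtains pos' where "noncrossing_order E V pos'" "pos' x = 0"
proof -
  define N where "N = Suc (Max (pos ` V))"
  have N: "pos v < N" if "v \<in> V" for v
    unfolding N_def using V that by (simp add: less_Suc_eq_le)
  define pos' where "pos' v = (if pos x \<le> pos v then pos v - pos x else N + pos v - pos x)" for v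
  have inj: "inj_on pos V" using pos by (simp add: noncrossing_order_def)
  have inj': "inj_on pos' V"
  proof (rule inj_onI)
    fix u v assume uv: "u \<in> V" "v \<in> V" "pos' u = pos' v"
    then have "pos u = pos v"
      using N[of u] N[of v] N[OF x] unfolding pos'_def by (auto split: if_splits)
    then show "u = v" using inj uv by (auto dest: inj_onD)
  qed
  have less_iff: "pos' u < pos' v \<longleftrightarrow> pos x \<le> pos u \<and> pos v < pos x \<or> pos u < pos v \<and> pos v < pos x \<or>
      pos x \<le> pos u \<and> pos u < pos v" if "u \<in> V" "v \<in> V" for u v
    using N[OF that(1)] N[OF that(2)] N[OF x] unfolding pos'_def by auto
  have "{b, d} \<notin> E"
    if V4: "a \<in> V" "b \<in> V" "c \<in> V" "d \<in> V" and ord: "pos' a < pos' b" "pos' b < pos' c" "pos' c < pos' d"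
      and e: "{a, c} \<in> E" for a b c d
  proof
    assume e': "{b, d} \<in> E"
    have e2: "{c, a} \<in> E" "{d, b} \<in> E" using e e' by (simp_all add: insert_commute)
    \<comment> \<open>In the old order the four vertices appear in one of the four cyclic rotations
      of \<open>a\<close>, \<open>b\<close>, \<open>c\<close>, \<open>d\<close>.\<close>
    have "pos a < pos b \<and> pos b < pos c \<and> pos c < pos d \<or> pos d < pos a \<and> pos a < pos b \<and> pos b < pos c \<or>
      pos c < pos d \<and> pos d < pos a \<and> pos a < pos b \<or> pos b < pos c \<and> pos c < pos d \<and> pos d < pos a"
      using ord unfolding less_iff[OF V4(1,2)] less_iff[OF V4(2,3)] less_iff[OF V4(3,4)] by linarith
    then show False
      using noncrossing_orderD[OF pos, of a b c d] noncrossing_orderD[OF pos, of d a b c]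
        noncrossing_orderD[OF pos, of c d a b] noncrossing_orderD[OF pos, of b c d a] V4 e e' e2 by blast
  qed
  then have "noncrossing_order E V pos'" using inj' unfolding noncrossing_order_def by blast
  moreover have "pos' x = 0" by (simp add: pos'_def)
  ultimately show thesis using that by blast
qed

text \<open>\<open>B\<close> is placed to the right of \<open>A\<close>, except that a common vertex
  \<open>x\<close> stays at the left end, where it is first in both orders. An edge of
  \<open>B\<close> at \<open>x\<close> then passes over the rest of \<open>A\<close> without
  separating the ends of any edge of \<open>A\<close>. So two crossing edges would have all four
  ends in \<open>A\<close> or all four in \<open>B\<close>.\<close>

lemma noncrossing_order_glue:
  assumes A: "noncrossing_order E A f" and B: "noncrossing_order E B g" and fin: "finite A"
    and AB: "A \<inter> B \<subseteq> {x}" and no_edge: "\<And>u v. u \<in> A - B \<Longrightarrow> v \<in> B - A \<Longrightarrow> {u, v} \<notin> E"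
    and x: "x \<in> A \<inter> B \<Longrightarrow> f x = 0 \<and> g x = 0"
  obtains pos where "noncrossing_order E (A \<union> B) pos"
proof -
  define N where "N = Suc (Max (insert 0 (f ` A)))"
  have N: "f v < N" if "v \<in> A" for v
    unfolding N_def using fin that by (auto simp: less_Suc_eq_le)
  define pos where "pos v = (if v \<in> A then f v else N + g v)" for v
  have posA: "pos v = f v" if "v \<in> A" for v using that by (simp add: pos_def)
  have posB: "pos v = N + g v" if "v \<notin> A" for v using that by (simp add: pos_def)
  have down: "u \<in> A" if "v \<in> A" "pos u < pos v" for u v
    using that N[of v] unfolding pos_def by (auto split: if_splits)
  have injA: "inj_on f A" and injB: "inj_on g B" using A B by (simp_all add: noncrossing_order_def)
  have g_less: "g u < g v" if "pos u < pos v" "u \<in> B" "v \<in> B" "v \<notin> A" for u v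
  proof (cases "u \<in> A")
    case True
    then have ux: "u = x" "g x = 0" using that AB x by auto
    have "v \<noteq> x" "x \<in> B" using that ux(1) True by auto
    then have "g v \<noteq> g x"
      using injB that(3) by (auto dest: inj_onD)
    then show ?thesis using ux by simp
  next
    case False
    then show ?thesis using that by (simp add: posB)
  qed
  have edge: "(u \<in> A \<and> v \<in> A) \<or> (u \<in> B \<and> v \<in> B)" if "{u, v} \<in> E" "u \<in> A \<union> B" "v \<in> A \<union> B" for u v
    using no_edge[of u v] no_edge[of v u] that by (auto simp: insert_commute)
  have min: "v \<notin> B" if "u \<in> A" "v \<in> A" "pos u < pos v" for u v
    using that AB x by (auto simp: posA)
  have "inj_on pos (A \<union> B)"
  proof (rule inj_onI)
    fix u v assume uv: "u \<in> A \<union> B" "v \<in> A \<union> B" "pos u = pos v"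
    have "u \<in> A \<longleftrightarrow> v \<in> A"
      using uv(3) N[of u] N[of v] unfolding pos_def by (auto split: if_splits)
    then show "u = v"
      using uv injA injB by (cases "u \<in> A") (auto simp: posA posB dest: inj_onD)
  qed
  moreover have "{b, d} \<notin> E"
    if V4: "a \<in> A \<union> B" "b \<in> A \<union> B" "c \<in> A \<union> B" "d \<in> A \<union> B"
      and ord: "pos a < pos b" "pos b < pos c" "pos c < pos d" and e: "{a, c} \<in> E" for a b c d
  proof
    assume e': "{b, d} \<in> E"
    show False
    proof (cases "b \<in> A")
      case bA: True
      then have aA: "a \<in> A" using down ord by blast
      have "b \<notin> B" using min[OF aA bA] ord by blast
      then have dA: "d \<in> A" using edge[OF e'] V4 by blast
      then have cA: "c \<in> A" using down ord by blast
      show False using noncrossing_orderD[OF A aA bA cA dA] ord e e' aA bA cA dA by (simp add: posA)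
    next
      case bA: False
      then have nA: "c \<notin> A" "d \<notin> A" using down ord by blast+
      then have "a \<in> B" using edge[OF e] V4 by blast
      then show False
        using noncrossing_orderD[OF B, of a b c d] g_less[of a b] g_less[of b c] g_less[of c d] ord V4 e e' bA nA
        by blast
    qed
  qed
  ultimately have "noncrossing_order E (A \<union> B) pos" unfolding noncrossing_order_def by blast
  then show thesis using that by blast
qed

section \<open>Cycles, ears and separations\<close>

lemma path_edges_join:
  "xs \<noteq> [] \<Longrightarrow> ys \<noteq> [] \<Longrightarrow> path_edges (xs @ ys) = insert {last xs, hd ys} (path_edges xs \<union> path_edges ys)"
proof (induction xs rule: path_edges.induct)
  case ("2_2" v)
  then show ?case by (cases ys) auto
qed auto

text \<open>A single edge counts as a cycle of length two, so a longest cycle exists as soon as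
  there is an edge between distinct vertices.\<close>

definition graph_cycle :: "'a set set \<Rightarrow> 'a list \<Rightarrow> bool" where
  "graph_cycle E c \<longleftrightarrow> graph_path E c \<and> 2 \<le> length c \<and> {last c, hd c} \<in> E"

lemma graph_cycle_rotate:
  assumes "graph_cycle E (xs @ ys)"
  shows "graph_cycle E (ys @ xs)"
proof (cases "xs = [] \<or> ys = []")
  case False
  then show ?thesis
    using assms unfolding graph_cycle_def graph_path_def by (auto simp: path_edges_join)
qed (use assms in auto)

lemma graph_cycle_paths:
  assumes "graph_cycle E (x # q1 @ y # q2)"
  shows "graph_path E (x # q1 @ [y])" "graph_path E (x # rev q2 @ [y])"
proof -
  show "graph_path E (x # q1 @ [y])"
    using assms path_edges_append[of "x # q1" y q2] unfolding graph_cycle_def graph_path_def by auto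
  have "path_edges (y # q2 @ [x]) = insert {last (y # q2), x} (path_edges (y # q2))"
    using path_edges_join[of "y # q2" "[x]"] by simp
  then have "graph_path E (y # q2 @ [x])"
    using assms path_edges_append[of "x # q1" y q2] unfolding graph_cycle_def graph_path_def by auto
  from graph_path_rev[OF this] show "graph_path E (x # rev q2 @ [y])" by simp
qed

text \<open>The ends of the ear split the cycle into two paths. If both have inner vertices, they
  form a theta with the ear; if one is a single edge, replacing it by the ear gives a longer
  cycle.\<close>

lemma longest_cycle_no_ear:
  assumes theta: "no_theta E" and c: "graph_cycle E c"
    and longest: "\<And>c'. graph_cycle E c' \<Longrightarrow> set c' \<subseteq> set c \<union> set q \<Longrightarrow> length c' \<le> length c"
    and ear: "graph_path E (x # q @ [y])" "q \<noteq> []" "x \<in> set c" "y \<in> set c" "set q \<inter> set c = {}"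
  shows False
proof -
  obtain a b where ab: "c = a @ x # b" using ear(3) by (meson split_list)
  have "y \<in> set (b @ a)" using ear ab by (auto simp: graph_path_def)
  then obtain q1 q2 where q12: "b @ a = q1 @ y # q2" by (meson split_list)
  have cyc: "graph_cycle E (x # q1 @ y # q2)"
    using graph_cycle_rotate[of E a "x # b"] c ab q12 by simp
  have set_c: "set c = {x, y} \<union> set q1 \<union> set q2"
    using arg_cong[OF q12, of set] ab by auto
  have len_c: "length c = length q1 + length q2 + 2"
    using arg_cong[OF q12, of length] ab by simp
  note paths = graph_cycle_paths[OF cyc]
  have dist: "distinct (x # q1 @ y # q2)" using cyc by (simp add: graph_cycle_def graph_path_def)
  consider "q1 \<noteq> []" "q2 \<noteq> []" | "q1 = []" | "q2 = []" by blast
  then show False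
  proof cases
    case 1
    have "set q1 \<inter> set (rev q2) = {}" "set q1 \<inter> set q = {}" "set (rev q2) \<inter> set q = {}" "rev q2 \<noteq> []"
      using dist ear(5) set_c 1 by auto
    then show False
      using theta paths ear(1,2) 1 unfolding no_theta_def by blast
  next
    case 2
    have "graph_cycle E (x # q @ y # q2)"
      using cyc ear dist set_c 2 path_edges_append[of "x # q" y q2]
      unfolding graph_cycle_def graph_path_def by auto
    then show False using longest[of "x # q @ y # q2"] len_c set_c 2 ear(2) by auto
  next
    case 3
    have e: "path_edges (x # q1 @ y # rev q) = path_edges (x # q1 @ [y]) \<union> path_edges (y # rev q)"
      using path_edges_append[of "x # q1" y "rev q"] by simp
    have "path_edges (y # rev q) = path_edges (q @ [y])"
      using path_edges_rev[of "q @ [y]"] by simp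
    moreover have q: "path_edges (x # q @ [y]) = insert {x, hd q} (path_edges (q @ [y]))"
      using ear(2) by (cases q) auto
    ultimately have "path_edges (x # q1 @ y # rev q) \<subseteq> E" "{hd q, x} \<in> E"
      using e paths(1) ear(1) unfolding graph_path_def by (auto simp: insert_commute)
    then have "graph_cycle E (x # q1 @ y # rev q)"
      using ear dist set_c 3 unfolding graph_cycle_def graph_path_def by (auto simp: last_rev)
    then show False using longest[of "x # q1 @ y # rev q"] len_c set_c 3 ear(2) by auto
  qed
qed

text \<open>The parts share at most one vertex, so besides a cut vertex this covers a disconnected
  \<open>V\<close>.\<close>

definition separable :: "'a set set \<Rightarrow> 'a set \<Rightarrow> bool" where
  "separable E V \<longleftrightarrow> (\<exists>A B x. A \<union> B = V \<and> A \<noteq> V \<and> B \<noteq> V \<and> A \<inter> B \<subseteq> {x} \<and>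
     (\<forall>u\<in>A - B. \<forall>v\<in>B - A. {u, v} \<notin> E))"

lemma separableI:
  assumes "A \<union> B = V" "A \<noteq> V" "B \<noteq> V" "A \<inter> B \<subseteq> {x}"
    "\<And>u v. u \<in> A - B \<Longrightarrow> v \<in> B - A \<Longrightarrow> {u, v} \<notin> E"
  shows "separable E V"
  using assms unfolding separable_def by blast

text \<open>Some edge leaves the cycle, say from \<open>x\<close> to \<open>v\<close>. If the
  vertices reachable from \<open>v\<close> off the cycle had no neighbour in \<open>V\<close>
  besides themselves and \<open>x\<close>, then \<open>x\<close> would separate them from the rest
  of the cycle. Thus they have another neighbour \<open>y\<close>, which lies on the cycle and ends
  the ear.\<close>

lemma nonseparable_ear:
  assumes ns: "\<not> separable E V" and c: "set c \<subseteq> V" "set c \<noteq> V" "distinct c" "2 \<le> length c"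
  obtains x y q where "graph_path E (x # q @ [y])" "q \<noteq> []" "x \<in> set c" "y \<in> set c"
    "set q \<inter> set c = {}" "set q \<subseteq> V"
proof -
  have "\<exists>x\<in>set c. \<exists>v\<in>V - set c. {x, v} \<in> E"
  proof (rule ccontr)
    assume n: "\<not> ?thesis"
    have "hd c \<in> set c" using c(4) by (cases c) auto
    then have "V - set c \<noteq> V" using c(1) by blast
    then have "separable E V"
      by (intro separableI[of "set c" "V - set c" V undefined]) (use c n in blast)+
    then show False using ns by blast
  qed
  then obtain x v where xv: "x \<in> set c" "v \<in> V" "v \<notin> set c" "{x, v} \<in> E" by blast
  define R where "R = {r. \<exists>q. graph_path E q \<and> q \<noteq> [] \<and> hd q = v \<and> last q = r \<and> set q \<subseteq> V - set c}"
  have "v \<in> R"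
    unfolding R_def using xv by (intro CollectI exI[of _ "[v]"]) (auto simp: graph_path_def)
  have R_sub: "R \<subseteq> V - set c" unfolding R_def using last_in_set by blast
  have R_step: "y \<in> R" if r: "r \<in> R" and e: "{r, y} \<in> E" and y: "y \<in> V - set c" for r y
  proof -
    obtain q where q: "graph_path E q" "q \<noteq> []" "hd q = v" "last q = r" "set q \<subseteq> V - set c"
      using r unfolding R_def by blast
    show ?thesis
    proof (cases "y \<in> set q")
      case True
      then obtain q1 q2 where q12: "q = q1 @ y # q2" by (meson split_list)
      then have "graph_path E (q1 @ [y])"
        using q(1) path_edges_append[of q1 y q2] unfolding graph_path_def by auto
      moreover have "hd (q1 @ [y]) = v" using q q12 by (cases q1) auto
      moreover have "set (q1 @ [y]) \<subseteq> V - set c" using q q12 by auto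
      ultimately show ?thesis unfolding R_def by (intro CollectI exI[of _ "q1 @ [y]"]) auto
    next
      case False
      then have "graph_path E (q @ [y])"
        using q e path_edges_join[of q "[y]"] unfolding graph_path_def by auto
      then show ?thesis unfolding R_def using q y by (intro CollectI exI[of _ "q @ [y]"]) auto
    qed
  qed
  have "\<exists>r\<in>R. \<exists>y\<in>V - R - {x}. {r, y} \<in> E"
  proof (rule ccontr)
    assume n: "\<not> ?thesis"
    have "\<not> set c \<subseteq> {x}"
    proof
      assume "set c \<subseteq> {x}"
      then have "card (set c) \<le> card {x}" by (intro card_mono) auto
      then show False using distinct_card[OF c(3)] c(4) by simp
    qed
    then obtain z where z: "z \<in> set c" "z \<noteq> x" by blast
    have xV: "x \<in> V" using xv c by blast
    have "separable E V"
    proof (rule separableI[of "insert x R" "V - R" V x])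
      show "insert x R \<noteq> V" using z R_sub c(1) by blast
      show "V - R \<noteq> V" using \<open>v \<in> R\<close> xv by blast
      show "{a, b} \<notin> E" if "a \<in> insert x R - (V - R)" "b \<in> V - R - insert x R" for a b
        using that n xV by blast
    qed (use R_sub xV in auto)
    then show False using ns by blast
  qed
  then obtain r y where ry: "r \<in> R" "y \<in> V" "y \<notin> R" "y \<noteq> x" "{r, y} \<in> E" by blast
  then have yc: "y \<in> set c" using R_step by blast
  obtain q where q: "graph_path E q" "q \<noteq> []" "hd q = v" "last q = r" "set q \<subseteq> V - set c"
    using ry unfolding R_def by blast
  have "path_edges (x # q @ [y]) = insert {x, v} (insert {r, y} (path_edges q))"
    using path_edges_join[of "[x]" "q @ [y]"] path_edges_join[of q "[y]"] q by auto
  then have "graph_path E (x # q @ [y])"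
    using q xv ry yc unfolding graph_path_def by auto
  then show thesis using that q xv yc by blast
qed

text \<open>Vertices are ordered by their index in \<open>c\<close>. The ends of two crossing edges
  alternate around the cycle, which is the configuration that \<open>no_crossing_chords\<close>
  forbids.\<close>

lemma graph_cycle_noncrossing_order:
  assumes chords: "no_crossing_chords E" and c: "graph_cycle E c"
  obtains pos where "noncrossing_order E (set c) pos"
proof -
  obtain pos where pos: "\<And>v. v \<in> set c \<Longrightarrow> pos v < length c \<and> c ! pos v = v"
    using in_set_conv_nth[of _ c] by metis
  have "inj_on pos (set c)" using pos by (metis inj_onI)
  moreover have "{u, w} \<notin> E"
    if V4: "x \<in> set c" "u \<in> set c" "y \<in> set c" "w \<in> set c"
      and ord: "pos x < pos u" "pos u < pos y" "pos y < pos w" and e: "{x, y} \<in> E" for x u y w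
  proof
    assume e': "{u, w} \<in> E"
    let ?m1 = "drop (Suc (pos x)) (take (pos y) c)" and ?m2 = "drop (Suc (pos y)) c" and ?a = "take (pos x) c"
    have c1: "c = take (pos y) c @ y # ?m2"
      using id_take_nth_drop[of "pos y" c] pos[OF V4(3)] by simp
    have c2: "take (pos y) c = ?a @ x # ?m1"
      using id_take_nth_drop[of "pos x" "take (pos y) c"] pos[OF V4(1)] pos[OF V4(3)] ord
      by (simp add: min_def)
    have c_eq: "c = ?a @ (x # ?m1 @ y # ?m2)"
      using trans[OF c1 arg_cong[OF c2, of "\<lambda>z. z @ y # ?m2"]] by (simp only: append_assoc append_Cons)
    have "graph_cycle E ((x # ?m1 @ y # ?m2) @ ?a)"
      by (rule graph_cycle_rotate) (subst c_eq[symmetric], rule c)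
    then have cyc: "graph_cycle E (x # ?m1 @ y # (?m2 @ ?a))" by simp
    have "?m1 ! (pos u - Suc (pos x)) = u" "pos u - Suc (pos x) < length ?m1"
      using pos[OF V4(2)] pos[OF V4(3)] ord by auto
    then have u: "u \<in> set ?m1" by (metis nth_mem)
    have "?m2 ! (pos w - Suc (pos y)) = w" "pos w - Suc (pos y) < length ?m2"
      using pos[OF V4(4)] ord by auto
    then have "w \<in> set ?m2" by (metis nth_mem)
    then have w: "w \<in> set (rev (?m2 @ ?a))" by simp
    have "set ?m1 \<inter> set (rev (?m2 @ ?a)) = {}"
      using cyc unfolding graph_cycle_def graph_path_def by auto
    then show False
      using chords graph_cycle_paths[OF cyc] u w e e' unfolding no_crossing_chords_def by blast
  qed
  ultimately have "noncrossing_order E (set c) pos" unfolding noncrossing_order_def by blast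
  then show thesis using that by blast
qed

text \<open>Only \<open>V\<close> shrinks in the induction while \<open>E\<close> stays fixed, so
  the excluded configurations remain excluded in both parts of a separation.\<close>

lemma noncrossing_order_exists:
  assumes theta: "no_theta E" and chords: "no_crossing_chords E" and loopless: "\<And>x. {x} \<notin> E"
    and "finite V"
  shows "\<exists>pos. noncrossing_order E V pos"
  using \<open>finite V\<close>
proof (induction "card V" arbitrary: V rule: less_induct)
  case less
  show ?case
  proof (cases "separable E V")
    case True
    then obtain A B x where AB: "A \<union> B = V" "A \<noteq> V" "B \<noteq> V" "A \<inter> B \<subseteq> {x}"
      and ne: "\<And>u v. u \<in> A - B \<Longrightarrow> v \<in> B - A \<Longrightarrow> {u, v} \<notin> E"
      unfolding separable_def by blast
    have fin: "finite A" "finite B" using AB less.prems by auto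
    \<comment> \<open>The order of each part is rotated so that the shared vertex comes first, as
      gluing requires.\<close>
    have rooted: "\<exists>f. noncrossing_order E C f \<and> (x \<in> C \<longrightarrow> f x = 0)" if "C \<subset> V" for C
    proof -
      have finC: "finite C" using that less.prems by (meson finite_subset psubset_imp_subset)
      have "card C < card V" by (rule psubset_card_mono[OF less.prems that])
      then obtain f where "noncrossing_order E C f"
        using less.hyps[OF _ finC] by blast
      show ?thesis
      proof (cases "x \<in> C")
        case True
        from noncrossing_order_rotate[OF \<open>noncrossing_order E C f\<close> finC this] show ?thesis by blast
      qed (use \<open>noncrossing_order E C f\<close> in blast)
    qed
    obtain f where f: "noncrossing_order E A f" "x \<in> A \<Longrightarrow> f x = 0" using rooted[of A] AB by blast
    obtain g where g: "noncrossing_order E B g" "x \<in> B \<Longrightarrow> g x = 0" using rooted[of B] AB by blast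
    show ?thesis
    proof (rule noncrossing_order_glue[OF f(1) g(1) fin(1) AB(4) ne])
      show "f x = 0 \<and> g x = 0" if "x \<in> A \<inter> B" using f(2) g(2) that by blast
    qed (use AB(1) in blast)+
  next
    case ns: False
    show ?thesis
    proof (cases "\<exists>u\<in>V. \<exists>w\<in>V. {u, w} \<in> E")
      case True
      then obtain u w where uw: "u \<in> V" "w \<in> V" "{u, w} \<in> E" by blast
      then have "u \<noteq> w" using loopless by force
      let ?P = "\<lambda>c. graph_cycle E c \<and> set c \<subseteq> V"
      \<comment> \<open>The edge itself, as a cycle of length two, starts the search for a longest
        cycle.\<close>
      have "?P [u, w]"
        using uw \<open>u \<noteq> w\<close> by (auto simp: graph_cycle_def graph_path_def insert_commute)
      moreover have "\<forall>c. ?P c \<longrightarrow> length c < Suc (card V)"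
      proof (intro allI impI)
        fix c assume "?P c"
        then have "card (set c) = length c" by (simp add: graph_cycle_def graph_path_def distinct_card)
        moreover have "card (set c) \<le> card V" using \<open>?P c\<close> less.prems by (intro card_mono) auto
        ultimately show "length c < Suc (card V)" by simp
      qed
      ultimately obtain c where c: "graph_cycle E c" "set c \<subseteq> V"
        and longest: "\<And>c'. graph_cycle E c' \<Longrightarrow> set c' \<subseteq> V \<Longrightarrow> length c' \<le> length c"
        using ex_has_greatest_nat[of ?P "[u, w]" length] by blast
      have "set c = V"
      proof (rule ccontr)
        assume "set c \<noteq> V"
        then obtain x y q where ear: "graph_path E (x # q @ [y])" "q \<noteq> []" "x \<in> set c" "y \<in> set c"
          "set q \<inter> set c = {}" "set q \<subseteq> V"
          using nonseparable_ear[OF ns c(2)] c(1) unfolding graph_cycle_def graph_path_def by metis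
        show False
          by (rule longest_cycle_no_ear[OF theta c(1) _ ear(1-5)]) (use longest c(2) ear(6) in blast)
      qed
      then show ?thesis using graph_cycle_noncrossing_order[OF chords c(1)] by metis
    next
      case False
      obtain pos :: "'a \<Rightarrow> nat" where "inj_on pos V"
        using finite_imp_inj_to_nat_seg[OF less.prems] by blast
      then have "noncrossing_order E V pos" using False unfolding noncrossing_order_def by blast
      then show ?thesis by blast
    qed
  qed
qed

theorem theorem30:
  "class_fractionally_fragile (\<lambda>G. real (treedepth G))
     (\<lambda>a. 2 * real a * (1 + of_int \<lceil>log 2 (real a)\<rceil>))
     (outerplanar_graphs :: 'a ugraph set)"
  unfolding class_fractionally_fragile_def
proof
  fix G :: "'a ugraph"
  assume "G \<in> outerplanar_graphs"
  then obtain p \<gamma> where G: "simple_graph G" and "plane_drawing G p \<gamma>"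
    "\<forall>v\<in>verts G. p v \<in> frontier (outside (drawing_image G p \<gamma>))"
    unfolding outerplanar_graphs_def outerplanar_def by blast
  then interpret outerplane_drawing G p \<gamma> by unfold_locales auto
  have "{x} \<notin> edges G" for x using edge_card[of "{x}"] by auto
  then obtain pos where "noncrossing_order (edges G) (verts G) pos"
    using noncrossing_order_exists[OF no_theta_edges no_crossing_chords_edges] G
    unfolding simple_graph_def by blast
  then show "fractionally_fragile (\<lambda>G. real (treedepth G))
      (\<lambda>a. 2 * real a * (1 + of_int \<lceil>log 2 (real a)\<rceil>)) G"
    by (rule fractionally_fragile_of_noncrossing_order[OF G])
qed

end
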